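(* For every integer $n\geq 1$ and every $n$-vertex outerplanar graph $G$, there exists a set $\mathcal I\subseteq V(G)$ such that $G[\mathcal I]$ has maximum degree at most $3$ and $|\mathcal I|\geq \frac{2}{3}n$.
   Context: An outerplanar graph is a (simple) graph admitting a planar drawing in which every vertex is incident to the outer face. $G[\mathcal I]$ denotes the subgraph of $G$ induced by $\mathcal I$. *)

theory Defs
  imports "HOL-Analysis.Analysis" "Graph_Theory.Digraph_Component"
begin

text \<open>
  Finite simple graphs are the locale \<^locale>\<open>graph\<close>: finite, symmetric, loop-free digraphs
  without parallel arcs. An undirected edge \<open>{u, v}\<close> is represented by the two arcs from \<open>u\<close> to \<open>v\<close>
  and from \<open>v\<close> to \<open>u\<close>, so the number of edges at \<open>v\<close> is \<open>out_degree G v\<close>.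
\<close>

definition edges :: "('a, 'b) pre_digraph \<Rightarrow> 'a set set" where
  "edges G = {{u, v} | u v. u \<rightarrow>\<^bsub>G\<^esub> v}"

text \<open>The \<open>0\<close> only gives the graph without vertices maximum degree \<open>0\<close>.\<close>

definition max_degree :: "('a, 'b) pre_digraph \<Rightarrow> nat" where
  "max_degree G = Max (insert 0 (out_degree G ` verts G))"

text \<open>
  A drawing without crossings in the plane \<^typ>\<open>complex\<close>: \<open>p\<close> places the vertices, and \<open>c e\<close> is a
  simple arc joining the two ends of the edge \<open>e\<close>. Indexing the arcs by undirected edges makes the
  two opposite arcs of the digraph share one curve.
\<close>

definition planar_drawing ::
  "('a, 'b) pre_digraph \<Rightarrow> ('a \<Rightarrow> complex) \<Rightarrow> ('a set \<Rightarrow> real \<Rightarrow> complex) \<Rightarrow> bool" where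
  "planar_drawing G p c \<longleftrightarrow>
     inj_on p (verts G) \<and>
     (\<forall>e\<in>edges G. arc (c e) \<and> {pathstart (c e), pathfinish (c e)} = p ` e \<and>
        path_image (c e) \<inter> p ` verts G = p ` e) \<and>
     (\<forall>e\<in>edges G. \<forall>f\<in>edges G. e \<noteq> f \<longrightarrow>
        path_image (c e) \<inter> path_image (c f) \<subseteq> p ` (e \<inter> f))"

definition drawing_points ::
  "('a, 'b) pre_digraph \<Rightarrow> ('a \<Rightarrow> complex) \<Rightarrow> ('a set \<Rightarrow> real \<Rightarrow> complex) \<Rightarrow> complex set" where
  "drawing_points G p c = p ` verts G \<union> (\<Union>e\<in>edges G. path_image (c e))"

text \<open>
  For a finite graph the drawing is compact, so \<^const>\<open>outside\<close> is the unique unbounded component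
  of its complement.
\<close>

definition outer_face ::
  "('a, 'b) pre_digraph \<Rightarrow> ('a \<Rightarrow> complex) \<Rightarrow> ('a set \<Rightarrow> real \<Rightarrow> complex) \<Rightarrow> complex set" where
  "outer_face G p c = outside (drawing_points G p c)"

definition outerplanar :: "('a, 'b) pre_digraph \<Rightarrow> bool" where
  "outerplanar G \<longleftrightarrow>
     (\<exists>p c. planar_drawing G p c \<and> (\<forall>v\<in>verts G. p v \<in> frontier (outer_face G p c)))"

end

theory Submission
  imports Defs "HOL-Library.Sublist"
begin

text \<open>
  In an outerplanar drawing no three internally disjoint paths, each with an inner vertex, join the
  same two vertices: one of them would run inside the closed curve formed by the other two. For
  the same reason no cycle has two crossing chords. These two exclusions yield a linear order of the
  vertices in which no two edges cross, by induction along cut vertices and 2-cuts.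

  Such an order splits a segment with ends \<open>u, v\<close> at the last inner neighbour \<open>w\<close> of \<open>u\<close> into two
  segments that only share \<open>w\<close> and the edge \<open>u v\<close>. A dynamic program over these segments records how
  many vertices must be deleted, depending on whether the ends are kept and how many kept
  neighbours they may have inside. Up to domination there are only eight cases, and each of them
  allows one to delete at most a third of the vertices.
\<close>

text \<open>Outerplanar graphs are 3-colourable, and deleting the smallest colour class keeps enough
  vertices, but it bounds no degree; hence the degree budgets at the ends of a segment. Cost is
  three times the number of deletions minus the number of inner vertices. Deleting the vertex where
  two segments meet then costs 2, keeping it costs -1, and the goal becomes a bound by a constant
  independent of the length, which is what makes finitely many cases possible. A case is a
  conjunction of bounds, because the surroundings decide which states of the ends will be needed.
  Where segments meet, edges are charged whether or not they exist, so neither a triangulation nor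
  connectedness of the graph is required. For the order, the obstacle is that two given vertices of
  a piece need not be possible ends: opposite vertices of a 4-cycle are not. Each piece therefore
  carries a witness that its two attachment vertices are joined outside of it. The exclusions speak
  of connected sets rather than paths so that such witnesses can be enlarged by simple
  unions.\<close>

hide_const (open) Digraph_Component.connected

text \<open>A one-page book embedding: vertices on a line, all edges on one side of it. Only
  left-to-right pairs are tested, as the relations in use are symmetric.\<close>

definition noncrossing :: "('a \<Rightarrow> 'a \<Rightarrow> bool) \<Rightarrow> 'a list \<Rightarrow> bool" where
  "noncrossing E xs \<longleftrightarrow> distinct xs \<and>
     (\<forall>a b c d. subseq [a, b, c, d] xs \<longrightarrow> E a c \<longrightarrow> \<not> E b d)"

section \<open>Large subsets of degree at most three from a noncrossing order\<close>

text \<open>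
  \<open>u # X @ [v]\<close> is a segment of a noncrossing order. For the end \<open>u\<close>, \<open>s = None\<close> means that \<open>u\<close> is
  deleted, and \<open>s = Some k\<close> that \<open>u\<close> is kept and may have \<open>k\<close> kept neighbours in \<open>X\<close>; likewise \<open>t\<close>
  for \<open>v\<close>. A possible edge between \<open>u\<close> and \<open>v\<close> is not counted. The number \<open>c\<close> bounds three times
  the number of deletions in \<open>X\<close>, relative to the length of \<open>X\<close>.
\<close>

definition completable ::
  "('a \<Rightarrow> 'a \<Rightarrow> bool) \<Rightarrow> 'a \<Rightarrow> 'a list \<Rightarrow> 'a \<Rightarrow> nat option \<Rightarrow> nat option \<Rightarrow> int \<Rightarrow> bool" where
  "completable E u X v s t c \<longleftrightarrow>
     (\<exists>K \<subseteq> set X. 3 * int (card (set X - K)) \<le> int (length X) + c \<and>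
        (\<forall>x\<in>K. card {y. E x y \<and> (y \<in> K \<or> s \<noteq> None \<and> y = u \<or> t \<noteq> None \<and> y = v)} \<le> 3) \<and>
        (\<forall>k. s = Some k \<longrightarrow> card {y \<in> K. E u y} \<le> k) \<and>
        (\<forall>k. t = Some k \<longrightarrow> card {y \<in> K. E v y} \<le> k))"

text \<open>The second state asks for no more than the first. \<open>None\<close> is weakest because
  a kept set stays admissible when an end is removed. The slack \<open>d\<close> is 1 when a kept
  meeting vertex becomes a new neighbour of the end.\<close>

fun weaker :: "nat \<Rightarrow> nat option \<Rightarrow> nat option \<Rightarrow> bool" where
  "weaker d s None = True"
| "weaker d None (Some k) = False"
| "weaker d (Some j) (Some k) = (j + d \<le> k)"

lemma weaker_refl [simp]: "weaker 0 s s"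
  by (cases s) auto

lemma card_Collect_le:
  assumes "card B \<le> n" "finite B" "\<And>y. P y \<Longrightarrow> y \<in> B"
  shows "card {y. P y} \<le> n"
proof -
  have "card {y. P y} \<le> card B" by (rule card_mono) (use assms in auto)
  then show ?thesis using assms(1) by simp
qed

lemma completable_mono:
  assumes "completable E u X v s t c" "weaker 0 s s'" "weaker 0 t t'" "c \<le> c'"
  shows "completable E u X v s' t' c'"
proof -
  obtain K where K: "K \<subseteq> set X" "3 * int (card (set X - K)) \<le> int (length X) + c"
    "\<And>x. x\<in>K \<Longrightarrow> card {y. E x y \<and> (y \<in> K \<or> s \<noteq> None \<and> y = u \<or> t \<noteq> None \<and> y = v)} \<le> 3"
    "\<And>k. s = Some k \<Longrightarrow> card {y \<in> K. E u y} \<le> k"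
    "\<And>k. t = Some k \<Longrightarrow> card {y \<in> K. E v y} \<le> k"
    using assms(1) unfolding completable_def by blast
  have alive: "s' \<noteq> None \<Longrightarrow> s \<noteq> None" "t' \<noteq> None \<Longrightarrow> t \<noteq> None"
    using assms(2,3) by (cases s; cases t; auto)+
  have fin: "finite K" using K(1) finite_subset by blast
  show ?thesis unfolding completable_def
  proof (intro exI[of _ K] conjI ballI allI impI)
    fix x assume "x \<in> K"
    then show "card {y. E x y \<and> (y \<in> K \<or> s' \<noteq> None \<and> y = u \<or> t' \<noteq> None \<and> y = v)} \<le> 3"
      using alive fin by (intro card_Collect_le[OF K(3)[of x]]) (simp_all, blast)
  next
    fix k assume "s' = Some k"
    then obtain j where "s = Some j" "j \<le> k" using assms(2) by (cases s) auto
    then show "card {y \<in> K. E u y} \<le> k" using K(4)[of j] by simp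
  next
    fix k assume "t' = Some k"
    then obtain j where "t = Some j" "j \<le> k" using assms(3) by (cases t) auto
    then show "card {y \<in> K. E v y} \<le> k" using K(5)[of j] by simp
  qed (use K(1,2) assms(4) in auto)
qed

section \<open>Joining two segments at a common vertex\<close>

locale split_at =
  fixes E :: "'a \<Rightarrow> 'a \<Rightarrow> bool" and u :: 'a and Y :: "'a list" and w :: 'a and Z :: "'a list" and v :: 'a
  assumes sym: "E x y \<Longrightarrow> E y x"
    and irr: "\<not> E x x"
    and dist: "distinct (u # Y @ w # Z @ [v])"
    and sep: "x \<in> insert u (set Y) \<Longrightarrow> y \<in> insert v (set Z) \<Longrightarrow> E x y \<Longrightarrow> x = u \<and> y = v"
begin

lemma no_edge:
  "x \<in> set Y \<Longrightarrow> y \<in> set Z \<Longrightarrow> \<not> E x y" "x \<in> set Z \<Longrightarrow> y \<in> set Y \<Longrightarrow> \<not> E x y"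
  "x \<in> set Y \<Longrightarrow> \<not> E x v" "x \<in> set Y \<Longrightarrow> \<not> E v x"
  "x \<in> set Z \<Longrightarrow> \<not> E x u" "x \<in> set Z \<Longrightarrow> \<not> E u x"
proof -
  have ne: "u \<notin> set Y" "v \<notin> set Z" using dist by auto
  show 1: "\<not> E x y" if "x \<in> set Y" "y \<in> set Z" for x y using sep[of x y] ne that by auto
  show 2: "\<not> E x v" if "x \<in> set Y" for x using sep[of x v] ne that by auto
  show 3: "\<not> E u x" if "x \<in> set Z" for x using sep[of u x] ne that by auto
  show "x \<in> set Z \<Longrightarrow> y \<in> set Y \<Longrightarrow> \<not> E x y" "x \<in> set Y \<Longrightarrow> \<not> E v x" "x \<in> set Z \<Longrightarrow> \<not> E x u"
    using 1 2 3 sym by blast+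
qed

text \<open>The 2 is the price 3 of deleting \<open>w\<close> minus the 1 by which \<open>w\<close>
  lengthens the segment. The kept sets of the two sides do not interact, by
  \<open>no_edge\<close>.\<close>

lemma completable_delete:
  assumes "completable E u Y w s None c1" "completable E w Z v None t c2"
  shows "completable E u (Y @ w # Z) v s t (c1 + c2 + 2)"
proof -
  obtain K1 where K1: "K1 \<subseteq> set Y" "3 * int (card (set Y - K1)) \<le> int (length Y) + c1"
    "\<And>x. x\<in>K1 \<Longrightarrow> card {y. E x y \<and> (y \<in> K1 \<or> s \<noteq> None \<and> y = u)} \<le> 3"
    "\<And>k. s = Some k \<Longrightarrow> card {y \<in> K1. E u y} \<le> k"
    using assms(1) unfolding completable_def by auto
  obtain K2 where K2: "K2 \<subseteq> set Z" "3 * int (card (set Z - K2)) \<le> int (length Z) + c2"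
    "\<And>x. x\<in>K2 \<Longrightarrow> card {y. E x y \<and> (y \<in> K2 \<or> t \<noteq> None \<and> y = v)} \<le> 3"
    "\<And>k. t = Some k \<Longrightarrow> card {y \<in> K2. E v y} \<le> k"
    using assms(2) unfolding completable_def by auto
  have fin: "finite K1" "finite K2" using K1(1) K2(1) finite_subset by blast+
  show ?thesis unfolding completable_def
  proof (intro exI[of _ "K1 \<union> K2"] conjI ballI allI impI)
    have "set (Y @ w # Z) - (K1 \<union> K2) \<subseteq> insert w ((set Y - K1) \<union> (set Z - K2))" by auto
    then have "card (set (Y @ w # Z) - (K1 \<union> K2)) \<le> card (insert w ((set Y - K1) \<union> (set Z - K2)))"
      by (intro card_mono) auto
    also have "\<dots> \<le> Suc (card ((set Y - K1) \<union> (set Z - K2)))"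
      by (simp add: card_insert_if)
    also have "\<dots> \<le> Suc (card (set Y - K1) + card (set Z - K2))"
      by (simp add: card_Un_le)
    finally show "3 * int (card (set (Y @ w # Z) - (K1 \<union> K2))) \<le> int (length (Y @ w # Z)) + (c1 + c2 + 2)"
      using K1(2) K2(2) by simp
  next
    fix x assume "x \<in> K1 \<union> K2"
    then consider "x \<in> K1" | "x \<in> K2" by blast
    then show "card {y. E x y \<and> (y \<in> K1 \<union> K2 \<or> s \<noteq> None \<and> y = u \<or> t \<noteq> None \<and> y = v)} \<le> 3"
    proof cases
      case 1
      then have "x \<in> set Y" using K1(1) by blast
      then have "y \<notin> K2 \<and> y \<noteq> v" if "E x y" for y
        using that K2(1) no_edge(1,3) by blast
      then show ?thesis using fin by (intro card_Collect_le[OF K1(3)[OF 1]]) auto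
    next
      case 2
      then have "x \<in> set Z" using K2(1) by blast
      then have "y \<notin> K1 \<and> y \<noteq> u" if "E x y" for y
        using that K1(1) no_edge(2,5) by blast
      then show ?thesis using fin by (intro card_Collect_le[OF K2(3)[OF 2]]) auto
    qed
  next
    fix k assume "s = Some k"
    moreover have "y \<notin> K2" if "E u y" for y
      using that K2(1) no_edge(6) by blast
    ultimately show "card {y \<in> K1 \<union> K2. E u y} \<le> k"
      using fin by (intro card_Collect_le[OF K1(4)]) auto
  next
    fix k assume "t = Some k"
    moreover have "y \<notin> K1" if "E v y" for y
      using that K1(1) no_edge(4) by blast
    ultimately show "card {y \<in> K1 \<union> K2. E v y} \<le> k"
      using fin by (intro card_Collect_le[OF K2(4)]) auto
  qed (use K1(1) K2(1) in auto)
qed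

text \<open>The -1 is the extra length without a deletion. Edges from \<open>w\<close> to kept ends
  are charged on both sides: as the \<open>of_bool\<close> terms in the degree of \<open>w\<close>,
  and as the successor in the budgets of \<open>u\<close> and \<open>v\<close>.\<close>

lemma completable_keep:
  assumes "completable E u Y w s (Some i) c1" "completable E w Z v (Some j) t c2"
    and ij: "i + j + of_bool (s \<noteq> None) + of_bool (t \<noteq> None) \<le> 3"
  shows "completable E u (Y @ w # Z) v (map_option Suc s) (map_option Suc t) (c1 + c2 - 1)"
proof -
  obtain K1 where K1: "K1 \<subseteq> set Y" "3 * int (card (set Y - K1)) \<le> int (length Y) + c1"
    "\<And>x. x\<in>K1 \<Longrightarrow> card {y. E x y \<and> (y \<in> K1 \<or> s \<noteq> None \<and> y = u \<or> y = w)} \<le> 3"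
    "\<And>k. s = Some k \<Longrightarrow> card {y \<in> K1. E u y} \<le> k" "card {y \<in> K1. E w y} \<le> i"
    using assms(1) unfolding completable_def by auto
  obtain K2 where K2: "K2 \<subseteq> set Z" "3 * int (card (set Z - K2)) \<le> int (length Z) + c2"
    "\<And>x. x\<in>K2 \<Longrightarrow> card {y. E x y \<and> (y \<in> K2 \<or> y = w \<or> t \<noteq> None \<and> y = v)} \<le> 3"
    "\<And>k. t = Some k \<Longrightarrow> card {y \<in> K2. E v y} \<le> k" "card {y \<in> K2. E w y} \<le> j"
    using assms(2) unfolding completable_def by auto
  have fin: "finite K1" "finite K2" using K1(1) K2(1) finite_subset by blast+
  let ?K = "insert w (K1 \<union> K2)"
  show ?thesis unfolding completable_def
  proof (intro exI[of _ ?K] conjI ballI allI impI)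
    have "set (Y @ w # Z) - ?K \<subseteq> (set Y - K1) \<union> (set Z - K2)" by auto
    then have "card (set (Y @ w # Z) - ?K) \<le> card ((set Y - K1) \<union> (set Z - K2))"
      by (intro card_mono) auto
    also have "\<dots> \<le> card (set Y - K1) + card (set Z - K2)" by (rule card_Un_le)
    finally show "3 * int (card (set (Y @ w # Z) - ?K)) \<le> int (length (Y @ w # Z)) + (c1 + c2 - 1)"
      using K1(2) K2(2) by simp
  next
    fix x assume "x \<in> ?K"
    then consider "x \<in> K1" | "x \<in> K2" | "x = w" by blast
    then show "card {y. E x y \<and> (y \<in> ?K \<or> map_option Suc s \<noteq> None \<and> y = u
        \<or> map_option Suc t \<noteq> None \<and> y = v)} \<le> 3"
    proof cases
      case 1
      then have "x \<in> set Y" using K1(1) by blast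
      then have "y \<notin> K2 \<and> y \<noteq> v" if "E x y" for y
        using that K2(1) no_edge(1,3) by blast
      then show ?thesis using fin by (intro card_Collect_le[OF K1(3)[OF 1]]) auto
    next
      case 2
      then have "x \<in> set Z" using K2(1) by blast
      then have "y \<notin> K1 \<and> y \<noteq> u" if "E x y" for y
        using that K1(1) no_edge(2,5) by blast
      then show ?thesis using fin by (intro card_Collect_le[OF K2(3)[OF 2]]) auto
    next
      case 3
      let ?u = "{y. s \<noteq> None \<and> y = u}" and ?v = "{y. t \<noteq> None \<and> y = v}"
      let ?A = "{y \<in> K1. E w y}" and ?B = "{y \<in> K2. E w y}"
      have "card (?A \<union> ?B \<union> ?u \<union> ?v) \<le> card ?A + card ?B + card ?u + card ?v"
        using card_Un_le[of "?A \<union> ?B \<union> ?u" ?v] card_Un_le[of "?A \<union> ?B" ?u] card_Un_le[of ?A ?B]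
        by linarith
      also have "card ?u = of_bool (s \<noteq> None)" by simp
      also have "card ?v = of_bool (t \<noteq> None)" by simp
      finally have "card (?A \<union> ?B \<union> ?u \<union> ?v) \<le> 3" using K1(5) K2(5) ij by linarith
      then show ?thesis using 3 fin irr
        by (elim card_Collect_le) auto
    qed
  next
    fix k assume "map_option Suc s = Some k"
    then obtain k' where k: "s = Some k'" "k = Suc k'" by auto
    have "card (insert w {y \<in> K1. E u y}) \<le> k"
      using K1(4)[OF k(1)] k(2) fin by (simp add: card_insert_if)
    moreover have "y \<notin> K2" if "E u y" for y
      using that K2(1) no_edge(6) by blast
    ultimately show "card {y \<in> ?K. E u y} \<le> k"
      using fin by (elim card_Collect_le) auto
  next
    fix k assume "map_option Suc t = Some k"
    then obtain k' where k: "t = Some k'" "k = Suc k'" by auto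
    have "card (insert w {y \<in> K2. E v y}) \<le> k"
      using K2(4)[OF k(1)] k(2) fin by (simp add: card_insert_if)
    moreover have "y \<notin> K1" if "E v y" for y
      using that K1(1) no_edge(4) by blast
    ultimately show "card {y \<in> ?K. E v y} \<le> k"
      using fin by (elim card_Collect_le) auto
  qed (use K1(1) K2(1) in auto)
qed

end

section \<open>A finite family of profiles closed under joining\<close>

type_synonym profile = "(nat option \<times> nat option \<times> int) list"

text \<open>
  Every noncrossing segment satisfies all bounds of at least one of these eight profiles. They
  were found by a computer search for a finite family that contains the profile of a single edge
  and is closed, up to weakening, under joining two segments at a common end.
\<close>

definition profiles :: "profile list" where
  "profiles =
    [[(Some 0, Some 0, 0)],
     [(Some 0, None, -2)],
     [(None, Some 0, -2)],
     [(Some 1, None, -3)],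
     [(None, Some 1, -3)],
     [(None, None, -4)],
     [(Some 1, Some 1, -1)],
     [(Some 1, Some 2, 1), (Some 2, Some 1, 1), (Some 2, Some 2, 0),
      (None, Some 2, -2), (Some 2, None, -2)]]"

text \<open>The disjuncts are the two fates of the meeting vertex: deleted, where its states
  \<open>t1\<close> and \<open>s2\<close> are irrelevant since every state weakens to
  \<open>None\<close>, or kept. In the second, ends count towards its degree according to the target
  states \<open>s\<close> and \<open>t\<close>, which may have been weakened to
  \<open>None\<close>.\<close>

fun derivable :: "profile \<Rightarrow> profile \<Rightarrow> nat option \<times> nat option \<times> int \<Rightarrow> bool" where
  "derivable P Q (s, t, c) \<longleftrightarrow>
     list_ex (\<lambda>(s1, t1, c1). list_ex (\<lambda>(s2, t2, c2).
       weaker 0 s1 s \<and> weaker 0 t2 t \<and> c1 + c2 + 2 \<le> c \<or>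
       weaker 1 s1 s \<and> weaker 1 t2 t \<and> c1 + c2 - 1 \<le> c \<and>
       (case (t1, s2) of (Some i, Some j) \<Rightarrow> i + j + of_bool (s \<noteq> None) + of_bool (t \<noteq> None) \<le> 3
          | _ \<Rightarrow> False)) Q) P"

text \<open>A finite evaluation of the 64 possible joins; it is the whole induction step for
  segments.\<close>

lemma profiles_closed:
  "list_all (\<lambda>P. list_all (\<lambda>Q. list_ex (list_all (derivable P Q)) profiles) profiles) profiles"
  by code_simp

definition satisfies :: "('a \<Rightarrow> 'a \<Rightarrow> bool) \<Rightarrow> 'a \<Rightarrow> 'a list \<Rightarrow> 'a \<Rightarrow> profile \<Rightarrow> bool" where
  "satisfies E u X v P \<longleftrightarrow> (\<forall>(s, t, c)\<in>set P. completable E u X v s t c)"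

lemma (in split_at) derivable_completable:
  assumes "satisfies E u Y w P" "satisfies E w Z v Q" "derivable P Q (s, t, c)"
  shows "completable E u (Y @ w # Z) v s t c"
proof -
  obtain s1 t1 c1 s2 t2 c2 where 1: "completable E u Y w s1 t1 c1"
    and 2: "completable E w Z v s2 t2 c2"
    and d: "weaker 0 s1 s \<and> weaker 0 t2 t \<and> c1 + c2 + 2 \<le> c \<or>
       weaker 1 s1 s \<and> weaker 1 t2 t \<and> c1 + c2 - 1 \<le> c \<and>
       (case (t1, s2) of (Some i, Some j) \<Rightarrow> i + j + of_bool (s \<noteq> None) + of_bool (t \<noteq> None) \<le> 3
          | _ \<Rightarrow> False)"
    using assms unfolding satisfies_def by (fastforce simp: list_ex_iff)
  show ?thesis
  proof (cases "weaker 0 s1 s \<and> weaker 0 t2 t \<and> c1 + c2 + 2 \<le> c")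
    case True
    have "completable E u Y w s1 None c1" "completable E w Z v None t2 c2"
      by (rule completable_mono[OF 1], simp_all) (rule completable_mono[OF 2], simp_all)
    from completable_mono[OF completable_delete[OF this]] show ?thesis
      using True by blast
  next
    case False
    then obtain i j where ij: "t1 = Some i" "s2 = Some j"
      "i + j + of_bool (s \<noteq> None) + of_bool (t \<noteq> None) \<le> 3"
      and w: "weaker 1 s1 s" "weaker 1 t2 t" "c1 + c2 - 1 \<le> c"
      using d by (auto split: option.splits)
    \<comment> \<open>An end that the target deletes is given up before joining; otherwise its
      possible edge to \<open>w\<close> would use up degree of \<open>w\<close>.\<close>
    define s1' where "s1' = (if s = None then None else s1)"
    define t2' where "t2' = (if t = None then None else t2)"
    have "completable E u Y w s1' (Some i) c1"
      using 1 unfolding ij(1) by (rule completable_mono) (simp_all add: s1'_def)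
    moreover have "completable E w Z v (Some j) t2' c2"
      using 2 unfolding ij(2) by (rule completable_mono) (simp_all add: t2'_def)
    moreover have "i + j + of_bool (s1' \<noteq> None) + of_bool (t2' \<noteq> None) \<le> 3"
      using ij(3) w(1,2) by (auto simp: s1'_def t2'_def)
    ultimately have "completable E u (Y @ w # Z) v (map_option Suc s1') (map_option Suc t2') (c1 + c2 - 1)"
      by (rule completable_keep)
    then show ?thesis
    proof (rule completable_mono)
      show "weaker 0 (map_option Suc s1') s" using w(1) by (cases s; cases s1) (auto simp: s1'_def)
      show "weaker 0 (map_option Suc t2') t" using w(2) by (cases t; cases t2) (auto simp: t2'_def)
    qed (rule w(3))
  qed
qed

lemma noncrossing_infix: "noncrossing E (xs @ ys @ zs) \<Longrightarrow> noncrossing E ys"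
  unfolding noncrossing_def
  by (metis distinct_append subseq_drop_many subseq_rev_drop_many)

lemma subseq_mem_Cons: "x \<in> set xs \<Longrightarrow> subseq ys zs \<Longrightarrow> subseq (x # ys) (xs @ zs)"
  using list_emb_append_mono[of "(=)" "[x]" xs ys zs] by (simp add: subseq_singleton_left)

lemma subseq_mid:
  assumes "x \<in> set ys" "y \<in> set zs"
  shows "subseq [u, x, w, y] (u # ys @ w # zs)"
  using assms by (auto simp: subseq_singleton_left intro!: subseq_mem_Cons)

lemma noncrossing_profile:
  assumes sym: "\<And>x y. E x y \<Longrightarrow> E y x" and irr: "\<And>x. \<not> E x x"
    and "noncrossing E (u # X @ [v])"
  shows "\<exists>P\<in>set profiles. satisfies E u X v P"
  using assms(3)
proof (induction "length X" arbitrary: u X v rule: less_induct)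
  case less
  show ?case
  proof (cases X)
    case Nil
    then have "satisfies E u X v [(Some 0, Some 0, 0)]"
      by (auto simp: satisfies_def completable_def)
    then show ?thesis by (auto simp: profiles_def)
  next
    case (Cons x X')
    have dist: "distinct (u # X @ [v])" using less.prems unfolding noncrossing_def by blast
    \<comment> \<open>If \<open>u\<close> has no inner neighbour, the first inner vertex serves as
      \<open>w\<close>, with \<open>Y\<close> empty.\<close>
    obtain Y w Z where X: "X = Y @ w # Z" and Z: "\<forall>z\<in>set Z. \<not> E u z"
      and Y: "E u w \<or> Y = []"
    proof (cases "\<exists>y\<in>set X. E u y")
      case True
      from split_list_last_prop[OF this] that show ?thesis by blast
    next
      case False
      with Cons that[of "[]" x X'] show ?thesis by auto
    qed
    \<comment> \<open>An edge from \<open>Y\<close> past \<open>w\<close> would cross the edge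
      \<open>u w\<close>, and edges from \<open>u\<close> into \<open>Z\<close> are excluded because
      \<open>w\<close> is the last inner neighbour.\<close>
    interpret split_at E u Y w Z v
    proof
      fix x y assume *: "x \<in> insert u (set Y)" "y \<in> insert v (set Z)" "E x y"
      show "x = u \<and> y = v"
      proof (cases "x = u")
        case True
        then show ?thesis using * Z by auto
      next
        case False
        then have "x \<in> set Y" "E u w" using * Y by auto
        moreover have "subseq [u, x, w, y] (u # X @ [v])"
          using subseq_mid[of x Y y "Z @ [v]" u w] * \<open>x \<in> set Y\<close> by (auto simp: X)
        ultimately show ?thesis using less.prems * unfolding noncrossing_def by blast
      qed
    qed (use sym irr dist X in auto)
    have "noncrossing E (u # Y @ [w])" "noncrossing E (w # Z @ [v])"
      using noncrossing_infix[of E "[]" "u # Y @ [w]" "Z @ [v]"]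
        noncrossing_infix[of E "u # Y" "w # Z @ [v]" "[]"] less.prems by (auto simp: X)
    then obtain P Q where P: "P \<in> set profiles" "satisfies E u Y w P"
      and Q: "Q \<in> set profiles" "satisfies E w Z v Q"
      using less.hyps[of Y u w] less.hyps[of Z w v] by (auto simp: X)
    then obtain R where R: "R \<in> set profiles" "\<forall>a\<in>set R. derivable P Q a"
      using profiles_closed unfolding list_all_iff list_ex_iff by blast
    have "satisfies E u X v R"
      unfolding satisfies_def using derivable_completable[OF P(2) Q(2)] R(2) X by blast
    then show ?thesis using R(1) by blast
  qed
qed

text \<open>The allowance 2 stands for the two ends, which count as vertices but not in the length
  of \<open>X\<close>; each deleted end costs 3. The edge \<open>u v\<close>, ignored within
  segments, is charged here through the \<open>of_bool\<close> terms of \<open>st\<close>.\<close>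

lemma completable_kept:
  assumes sym: "\<And>x y. E x y \<Longrightarrow> E y x" and irr: "\<And>x. \<not> E x x"
    and dist: "distinct (u # X @ [v])"
    and c: "completable E u X v s t c" "c + 3 * of_bool (s = None) + 3 * of_bool (t = None) \<le> 2"
    and st: "\<And>k. s = Some k \<Longrightarrow> k + of_bool (t \<noteq> None) \<le> 3" "\<And>k. t = Some k \<Longrightarrow> k + of_bool (s \<noteq> None) \<le> 3"
  shows "\<exists>I\<subseteq>set (u # X @ [v]). (\<forall>x\<in>I. card {y \<in> I. E x y} \<le> 3) \<and>
           2 * length (u # X @ [v]) \<le> 3 * card I"
proof -
  obtain K where K: "K \<subseteq> set X" "3 * int (card (set X - K)) \<le> int (length X) + c"
    "\<And>x. x\<in>K \<Longrightarrow> card {y. E x y \<and> (y \<in> K \<or> s \<noteq> None \<and> y = u \<or> t \<noteq> None \<and> y = v)} \<le> 3"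
    "\<And>k. s = Some k \<Longrightarrow> card {y \<in> K. E u y} \<le> k"
    "\<And>k. t = Some k \<Longrightarrow> card {y \<in> K. E v y} \<le> k"
    using c(1) unfolding completable_def by blast
  have fin: "finite K" using K(1) finite_subset by blast
  define I where "I = K \<union> {x. s \<noteq> None \<and> x = u} \<union> {x. t \<noteq> None \<and> x = v}"
  have uv: "u \<notin> K" "v \<notin> K" "u \<noteq> v" using K(1) dist by auto
  have cI: "card I = card K + of_bool (s \<noteq> None) + of_bool (t \<noteq> None)"
    using uv fin unfolding I_def by (cases s; cases t) auto
  have "card (set X) = length X" using dist by (simp add: distinct_card)
  then have "card (set X - K) = length X - card K" "card K \<le> length X"
    using K(1) fin by (simp_all add: card_Diff_subset) (metis card_mono finite_set)
  then have "2 * length (u # X @ [v]) \<le> 3 * card I"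
    using K(2) c(2) unfolding cI by (cases s; cases t) auto
  moreover have "card {y \<in> I. E x y} \<le> 3" if "x \<in> I" for x
  proof -
    consider "x \<in> K" | k where "x = u" "s = Some k" | k where "x = v" "t = Some k"
      using \<open>x \<in> I\<close> unfolding I_def by auto
    then show ?thesis
    proof cases
      case 1
      then show ?thesis using fin by (intro card_Collect_le[OF K(3)[OF 1]]) (auto simp: I_def)
    next
      case 2
      have "card ({y \<in> K. E u y} \<union> {y. t \<noteq> None \<and> y = v}) \<le> k + of_bool (t \<noteq> None)"
        using card_Un_le[of "{y \<in> K. E u y}" "{y. t \<noteq> None \<and> y = v}"] K(4)[OF 2(2)]
        by (cases "t = None") simp_all
      then have "card ({y \<in> K. E u y} \<union> {y. t \<noteq> None \<and> y = v}) \<le> 3" using st(1)[OF 2(2)] by linarith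
      then show ?thesis using fin 2 irr by (elim card_Collect_le) (auto simp: I_def)
    next
      case 3
      have "card ({y \<in> K. E v y} \<union> {y. s \<noteq> None \<and> y = u}) \<le> k + of_bool (s \<noteq> None)"
        using card_Un_le[of "{y \<in> K. E v y}" "{y. s \<noteq> None \<and> y = u}"] K(5)[OF 3(2)]
        by (cases "s = None") simp_all
      then have "card ({y \<in> K. E v y} \<union> {y. s \<noteq> None \<and> y = u}) \<le> 3" using st(2)[OF 3(2)] by linarith
      then show ?thesis using fin 3 irr by (elim card_Collect_le) (auto simp: I_def)
    qed
  qed
  moreover have "I \<subseteq> set (u # X @ [v])" using K(1) by (auto simp: I_def)
  ultimately show ?thesis by blast
qed

text \<open>The profile \<open>[(None, None, -4)]\<close> meets the allowance with equality.\<close>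

lemma profiles_sufficient:
  "list_all (list_ex (\<lambda>(s, t, c). c + 3 * of_bool (s = None) + 3 * of_bool (t = None) \<le> 2 \<and>
     (case s of None \<Rightarrow> True | Some k \<Rightarrow> k + of_bool (t \<noteq> None) \<le> 3) \<and>
     (case t of None \<Rightarrow> True | Some k \<Rightarrow> k + of_bool (s \<noteq> None) \<le> 3))) profiles"
  by code_simp

theorem noncrossing_large_subset:
  assumes sym: "\<And>x y. E x y \<Longrightarrow> E y x" and irr: "\<And>x. \<not> E x x" and nc: "noncrossing E xs"
  shows "\<exists>I\<subseteq>set xs. (\<forall>x\<in>I. card {y \<in> I. E x y} \<le> 3) \<and> 2 * length xs \<le> 3 * card I"
proof -
  consider "length xs \<le> 1" | u X v where "xs = u # X @ [v]"
    by (cases xs; cases "tl xs" rule: rev_cases) auto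
  then show ?thesis
  proof cases
    case 1
    have "card {y \<in> set xs. E x y} \<le> 3" for x
      using card_mono[of "set xs" "{y \<in> set xs. E x y}"] card_length[of xs] 1 by simp
    moreover have "2 * length xs \<le> 3 * card (set xs)"
      using nc by (simp add: noncrossing_def distinct_card)
    ultimately show ?thesis by blast
  next
    case 2
    obtain P where P: "P \<in> set profiles" "satisfies E u X v P"
      using noncrossing_profile[where E = E, OF sym irr] nc 2 by blast
    obtain s t c where stc: "(s, t, c) \<in> set P"
      and *: "c + 3 * of_bool (s = None) + 3 * of_bool (t = None) \<le> 2"
      "case s of None \<Rightarrow> True | Some k \<Rightarrow> k + of_bool (t \<noteq> None) \<le> 3"
      "case t of None \<Rightarrow> True | Some k \<Rightarrow> k + of_bool (s \<noteq> None) \<le> 3"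
      using profiles_sufficient P(1) by (fastforce simp: list_all_iff list_ex_iff)
    have cc: "completable E u X v s t c" using P(2) stc unfolding satisfies_def by blast
    show ?thesis unfolding 2
      by (rule completable_kept[where E = E, OF sym irr _ cc]) (use * nc 2 in \<open>auto simp: noncrossing_def\<close>)
  qed
qed

section \<open>Operations on noncrossing orders\<close>

lemma noncrossingI:
  assumes "distinct xs" "\<And>a b c d. subseq [a, b, c, d] xs \<Longrightarrow> E a c \<Longrightarrow> E b d \<Longrightarrow> False"
  shows "noncrossing E xs"
  using assms unfolding noncrossing_def by blast

lemma noncrossingD: "noncrossing E xs \<Longrightarrow> subseq [a, b, c, d] xs \<Longrightarrow> E a c \<Longrightarrow> E b d \<Longrightarrow> False"
  unfolding noncrossing_def by blast

lemma noncrossing_distinct: "noncrossing E xs \<Longrightarrow> distinct xs"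
  unfolding noncrossing_def by blast

lemma noncrossing_Nil [simp]: "noncrossing E []"
  and noncrossing_singleton [simp]: "noncrossing E [x]"
  by (auto simp: noncrossing_def split: if_splits)

lemma noncrossing_subrel: "noncrossing E xs \<Longrightarrow> (\<And>x y. F x y \<Longrightarrow> E x y) \<Longrightarrow> noncrossing F xs"
  unfolding noncrossing_def by blast

lemma subseq4_appendE:
  assumes "subseq [a, b, c, d] (xs @ ys)"
  obtains "subseq [a, b, c, d] xs" | "subseq [a, b, c] xs" "d \<in> set ys"
  | "subseq [a, b] xs" "subseq [c, d] ys" | "a \<in> set xs" "subseq [b, c, d] ys"
  | "subseq [a, b, c, d] ys"
proof -
  obtain p q where pq: "[a, b, c, d] = p @ q" "subseq p xs" "subseq q ys"
    using assms by (elim subseq_appendE)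
  from pq(1) consider "q = []" | "p = [a, b, c]" "q = [d]" | "p = [a, b]" "q = [c, d]"
    | "p = [a]" "q = [b, c, d]" | "p = []"
    by (auto simp: Cons_eq_append_conv)
  then show ?thesis
  proof cases
    case 1 with pq show ?thesis by (intro that(1)) simp
  next
    case 2 with pq show ?thesis by (intro that(2)) (simp_all add: subseq_singleton_left)
  next
    case 3 with pq show ?thesis by (intro that(3)) simp_all
  next
    case 4 with pq show ?thesis by (intro that(4)) (simp_all add: subseq_singleton_left)
  next
    case 5 with pq show ?thesis by (intro that(5)) simp
  qed
qed

lemma subseq_rev_mono: "subseq xs ys \<Longrightarrow> subseq (rev xs) (rev ys)"
proof (induction rule: list_emb.induct)
  case (list_emb_Cons xs ys y)
  then show ?case by (simp add: subseq_rev_drop_many)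
qed simp_all

lemma subseq_set: "subseq xs ys \<Longrightarrow> set xs \<subseteq> set ys"
  by (auto dest: list_emb_set)

lemma subseq_tail: "subseq (a # as) (v # xs) \<Longrightarrow> subseq as xs"
  by (metis subseq_Cons' subseq_Cons2_iff)

lemma subseq_butlast: assumes "subseq (as @ [a]) (xs @ [v])" shows "subseq as xs"
proof -
  have "subseq (a # rev as) (v # rev xs)" using subseq_rev_mono[OF assms] by simp
  from subseq_rev_mono[OF subseq_tail[OF this]] show ?thesis by simp
qed

text \<open>Crossing depends only on the cyclic order; a rotation may reverse the orientation of an
  edge, hence the symmetry.\<close>

lemma noncrossing_rotate:
  assumes sym: "\<And>x y. E x y \<Longrightarrow> E y x" and nc: "noncrossing E (xs @ ys)"
  shows "noncrossing E (ys @ xs)"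
proof (rule noncrossingI)
  show "distinct (ys @ xs)" using noncrossing_distinct[OF nc] by auto
next
  fix a b c d assume "subseq [a, b, c, d] (ys @ xs)" and E: "E a c" "E b d"
  then obtain p q where pq: "[a, b, c, d] = p @ q" "subseq (q @ p) (xs @ ys)"
    by (elim subseq_appendE) (blast intro: list_emb_append_mono)
  from pq(1) consider "q = []" "p = [a, b, c, d]" | "p = [a, b, c]" "q = [d]" | "p = [a, b]" "q = [c, d]"
    | "p = [a]" "q = [b, c, d]" | "p = []" "q = [a, b, c, d]"
    by (auto simp: Cons_eq_append_conv)
  then show False
    using pq(2) E E[THEN sym] noncrossingD[OF nc] by cases auto
qed

lemma noncrossing_rev:
  assumes sym: "\<And>x y. E x y \<Longrightarrow> E y x" and nc: "noncrossing E xs"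
  shows "noncrossing E (rev xs)"
proof (rule noncrossingI)
  show "distinct (rev xs)" using noncrossing_distinct[OF nc] by auto
next
  fix a b c d assume "subseq [a, b, c, d] (rev xs)" and E: "E a c" "E b d"
  from subseq_rev_mono[OF this(1)] have "subseq [d, c, b, a] xs" by simp
  from noncrossingD[OF nc this] E[THEN sym] show False by blast
qed

lemma noncrossing_append:
  assumes "noncrossing E xs" "noncrossing E ys" "set xs \<inter> set ys = {}"
    and no: "\<And>x y. x \<in> set xs \<Longrightarrow> y \<in> set ys \<Longrightarrow> \<not> E x y"
  shows "noncrossing E (xs @ ys)"
proof (rule noncrossingI)
  show "distinct (xs @ ys)" using assms by (auto dest: noncrossing_distinct)
next
  fix a b c d assume "subseq [a, b, c, d] (xs @ ys)" and E: "E a c" "E b d"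
  then show False
  proof (cases rule: subseq4_appendE)
    case 1
    then show ?thesis using noncrossingD assms(1) E by metis
  next
    case 2
    then show ?thesis using subseq_set[OF 2(1)] no[of b d] E by auto
  next
    case 3
    then show ?thesis using subseq_set[OF 3(1)] subseq_set[OF 3(2)] no[of b d] E by auto
  next
    case 4
    then show ?thesis using no[of a c] E subseq_set[OF 4(2)] by auto
  next
    case 5
    then show ?thesis using noncrossingD assms(2) E by metis
  qed
qed

text \<open>Gluing at a cut vertex. If two crossing edges straddle the blocks, one of them joins the
  blocks, unless the leftmost vertex is \<open>v\<close>, and then they already cross in the second
  order.\<close>

lemma noncrossing_wedge:
  assumes nc: "noncrossing E (v # xs)" "noncrossing E (v # ys)" and disj: "set xs \<inter> set ys = {}"
    and no: "\<And>x y. x \<in> set xs \<Longrightarrow> y \<in> set ys \<Longrightarrow> \<not> E x y"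
  shows "noncrossing E (v # xs @ ys)"
proof (rule noncrossingI)
  show "distinct (v # xs @ ys)" using nc disj by (auto dest!: noncrossing_distinct)
next
  fix a b c d assume "subseq [a, b, c, d] (v # xs @ ys)" and E: "E a c" "E b d"
  then have "subseq [a, b, c, d] ((v # xs) @ ys)" by simp
  then show False
  proof (cases rule: subseq4_appendE)
    case 1
    then show ?thesis using noncrossingD nc(1) E by metis
  next
    case 2
    then show ?thesis using subseq_set[OF subseq_tail[OF 2(1)]] no[of b d] E by auto
  next
    case 3
    then show ?thesis using subseq_set[OF subseq_tail[OF 3(1)]] subseq_set[OF 3(2)] no[of b d] E by auto
  next
    case 4
    then have "a = v" using no[of a c] E subseq_set[OF 4(2)] by auto
    then have "subseq [a, b, c, d] (v # ys)" using 4(2) by simp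
    then show ?thesis using noncrossingD[OF nc(2)] E by blast
  next
    case 5
    then have "subseq [a, b, c, d] (v # ys)" by (rule list_emb_Cons)
    then show ?thesis using noncrossingD[OF nc(2)] E by blast
  qed
qed

text \<open>Rotation brings \<open>v\<close> to the front, where the two orders can be glued at
  it.\<close>

lemma noncrossing_insert:
  assumes sym: "\<And>x y. E x y \<Longrightarrow> E y x"
    and nc: "noncrossing E (us @ v # vs)" "noncrossing E (v # as)"
    and "set as \<inter> set (us @ vs) = {}" "\<And>x y. x \<in> set as \<Longrightarrow> y \<in> set (us @ vs) \<Longrightarrow> \<not> E x y"
  shows "noncrossing E (us @ v # as @ vs)"
proof -
  have "noncrossing E (v # vs @ us)" using noncrossing_rotate[OF sym nc(1)] by simp
  then have "noncrossing E ((v # as @ vs) @ us)"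
    using noncrossing_wedge[OF nc(2), of "vs @ us"] assms(4,5) by auto
  from noncrossing_rotate[OF sym this] show ?thesis by simp
qed

text \<open>First and last vertex are neighbours in the cyclic order, so an edge between them
  crosses nothing. It can be set aside while an order is assembled and restored at the end.\<close>

lemma noncrossing_close:
  assumes nc: "noncrossing F (u # zs @ [v])"
    and F: "\<And>x y. E x y \<Longrightarrow> F x y \<or> {x, y} = {u, v}"
  shows "noncrossing E (u # zs @ [v])"
proof (rule noncrossingI)
  show dist: "distinct (u # zs @ [v])" by (rule noncrossing_distinct[OF nc])
  fix a b c d assume s: "subseq [a, b, c, d] (u # zs @ [v])" and E: "E a c" "E b d"
  have "subseq [b, c, d] (zs @ [v])" using subseq_tail[OF s] .
  moreover have "subseq [a, b, c] (u # zs)" using subseq_butlast[of "[a, b, c]" d "u # zs" v] s by simp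
  ultimately have "{b, c, d} \<subseteq> set (zs @ [v])" "{a, b, c} \<subseteq> set (u # zs)"
    by (auto dest!: subseq_set simp del: subseq_Cons2_iff)
  then have "b \<noteq> u" "d \<noteq> u" "a \<noteq> v" "c \<noteq> v" using dist by auto
  then have "F a c" "F b d" using F E by (auto simp: doubleton_eq_iff)
  then show False using noncrossingD[OF nc s] by blast
qed

text \<open>Once the edge \<open>u v\<close> is set aside, \<open>w\<close> is a cut vertex and the
  two orders are glued there.\<close>

lemma noncrossing_join:
  assumes sym: "\<And>x y. E x y \<Longrightarrow> E y x"
    and nc: "noncrossing E (u # xs @ [w])" "noncrossing E (w # ys @ [v])"
    and disj: "set (u # xs) \<inter> set (ys @ [v]) = {}"
    and no: "\<And>x y. x \<in> set (u # xs) \<Longrightarrow> y \<in> set (ys @ [v]) \<Longrightarrow> E x y \<Longrightarrow> x = u \<and> y = v"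
  shows "noncrossing E (u # xs @ w # ys @ [v])"
proof -
  define F where "F x y \<longleftrightarrow> E x y \<and> {x, y} \<noteq> {u, v}" for x y
  have symF: "F x y \<Longrightarrow> F y x" for x y
    using sym[of x y] unfolding F_def by (simp add: insert_commute)
  have 1: "noncrossing F (w # u # xs)"
    using noncrossing_rotate[where E = F, OF symF, of "u # xs" "[w]"] noncrossing_subrel[OF nc(1), of F]
    by (auto simp: F_def)
  have 2: "noncrossing F (w # ys @ [v])"
    using noncrossing_subrel[OF nc(2), of F] by (auto simp: F_def)
  have 3: "\<not> F y x" if "y \<in> set (ys @ [v])" "x \<in> set (u # xs)" for x y
    using no[OF that(2,1)] sym[of y x] unfolding F_def by auto
  have "noncrossing F (w # (ys @ [v]) @ (u # xs))"
    using 3 by (intro noncrossing_wedge[OF 2 1]) (use disj in blast)+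
  then have "noncrossing F ((u # xs) @ (w # ys @ [v]))"
    using noncrossing_rotate[where E = F, OF symF, of "w # ys @ [v]" "u # xs"] by simp
  then have "noncrossing E (u # (xs @ w # ys) @ [v])"
    by - (rule noncrossing_close[of F], auto simp: F_def)
  then show ?thesis by simp
qed

lemma noncrossing_link:
  assumes nc: "noncrossing E (u # xs)" "noncrossing E (ys @ [v])"
    and disj: "set (u # xs) \<inter> set (ys @ [v]) = {}"
    and no: "\<And>x y. x \<in> set (u # xs) \<Longrightarrow> y \<in> set (ys @ [v]) \<Longrightarrow> E x y \<Longrightarrow> x = u \<and> y = v"
  shows "noncrossing E (u # xs @ ys @ [v])"
proof -
  define F where "F x y \<longleftrightarrow> E x y \<and> {x, y} \<noteq> {u, v}" for x y
  have "noncrossing F (u # xs)" "noncrossing F (ys @ [v])"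
    using noncrossing_subrel[OF nc(1), of F] noncrossing_subrel[OF nc(2), of F] by (auto simp: F_def)
  moreover have "\<not> F x y" if "x \<in> set (u # xs)" "y \<in> set (ys @ [v])" for x y
    using no[OF that] unfolding F_def by auto
  ultimately have "noncrossing F ((u # xs) @ (ys @ [v]))"
    by (rule noncrossing_append[OF _ _ disj])
  then have "noncrossing E (u # (xs @ ys) @ [v])"
    by - (rule noncrossing_close[of F], auto simp: F_def)
  then show ?thesis by simp
qed

text \<open>Going around a circle through \<open>u\<close> and \<open>v\<close>, one side is read
  forwards and the other backwards; a crossing pair then already crosses within one of the
  sides.\<close>

lemma noncrossing_glue:
  assumes sym: "\<And>x y. E x y \<Longrightarrow> E y x"
    and nc: "noncrossing E (u # xs @ [v])" "noncrossing E (u # ys @ [v])"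
    and disj: "set xs \<inter> set ys = {}"
    and no: "\<And>x y. x \<in> set xs \<Longrightarrow> y \<in> set ys \<Longrightarrow> \<not> E x y"
  shows "noncrossing E (u # xs @ v # rev ys)"
proof (rule noncrossingI)
  have dist: "distinct (u # xs @ [v])" "distinct (u # ys @ [v])" using nc by (auto dest!: noncrossing_distinct)
  then show "distinct (u # xs @ v # rev ys)" using disj by auto
  fix a b c d assume s: "subseq [a, b, c, d] (u # xs @ v # rev ys)" and E: "E a c" "E b d"
  have nc2: "noncrossing E (u # ys @ [v])" using nc(2) .
  have "subseq [a, b, c, d] ((u # xs @ [v]) @ rev ys)" using s by simp
  then show False
  proof (cases rule: subseq4_appendE)
    case 1
    then show ?thesis using noncrossingD nc(1) E by metis
  next
    case 2
    have "subseq [a, b] (u # xs)" using subseq_butlast[of "[a, b]" c "u # xs" v] 2 by simp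
    from subseq_set[OF subseq_tail[OF this]] have "b \<in> set xs" by simp
    then show ?thesis using no[of b d] E 2 by auto
  next
    case 3
    have cd: "subseq [d, c] ys" using subseq_rev_mono[OF 3(2)] by simp
    have "a \<notin> set xs" "b \<notin> set xs" using no[of a c] no[of b d] subseq_set[OF cd] E by auto
    moreover have "b \<in> set (xs @ [v])" using subseq_set[OF subseq_tail[OF 3(1)]] by simp
    moreover have "a \<in> set (u # xs)"
      using subseq_set[OF subseq_butlast[of "[a]" b "u # xs" v]] 3(1) by simp
    ultimately have "a = u" "b = v" by auto
    then have "subseq [u, d, c, v] (u # ys @ [v])" using subseq_append[of "[d, c]" "[v]" ys] cd by simp
    then show ?thesis using noncrossingD[OF nc2] E sym \<open>a = u\<close> \<open>b = v\<close> by blast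
  next
    case 4
    have cd: "subseq [d, c, b] ys" using subseq_rev_mono[OF 4(2)] by simp
    have "a \<notin> set xs" using no[of a c] subseq_set[OF cd] E by auto
    then consider "a = u" | "a = v" using 4(1) by auto
    then show ?thesis
    proof cases
      case 1
      then have "subseq [a, d, c, b] (u # ys @ [v])" using cd by (simp add: subseq_rev_drop_many)
      then show ?thesis using noncrossingD[OF nc2] E sym by blast
    next
      case 2
      then have "subseq [d, c, b, a] (u # ys @ [v])"
        using list_emb_Cons[of "(=)" "[d, c, b, v]" "ys @ [v]" u] subseq_append[of "[d, c, b]" "[v]" ys] cd
        by simp
      then show ?thesis using noncrossingD[OF nc2] E sym by blast
    qed
  next
    case 5
    then have "subseq [d, c, b, a] ys" using subseq_rev_mono[OF 5] by simp
    then have "subseq [d, c, b, a] (u # ys @ [v])" by (intro list_emb_Cons subseq_rev_drop_many)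
    then show ?thesis using noncrossingD[OF nc2] E sym by blast
  qed
qed

section \<open>Noncrossing orders from excluded subdivisions\<close>

definition connected_in :: "('a \<Rightarrow> 'a \<Rightarrow> bool) \<Rightarrow> 'a set \<Rightarrow> bool" where
  "connected_in E I \<longleftrightarrow> (\<forall>x\<in>I. \<forall>y\<in>I. (\<lambda>a b. E a b \<and> a \<in> I \<and> b \<in> I)\<^sup>*\<^sup>* x y)"

definition touches :: "('a \<Rightarrow> 'a \<Rightarrow> bool) \<Rightarrow> 'a set \<Rightarrow> 'a \<Rightarrow> bool" where
  "touches E I x \<longleftrightarrow> (\<exists>y\<in>I. E x y)"

lemma touches_mono: "touches E I x \<Longrightarrow> I \<subseteq> J \<Longrightarrow> touches E J x"
  unfolding touches_def by blast

lemma connected_in_empty [simp]: "connected_in E {}"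
  and connected_in_singleton [simp]: "connected_in E {x}"
  unfolding connected_in_def by auto

lemma connected_in_Un:
  assumes sym: "\<And>x y. E x y \<Longrightarrow> E y x" and I: "connected_in E I" and J: "connected_in E J"
    and ab: "a \<in> I" "b \<in> J" "E a b"
  shows "connected_in E (I \<union> J)"
proof -
  let ?R = "\<lambda>x y. E x y \<and> x \<in> I \<union> J \<and> y \<in> I \<union> J"
  have mono: "?R\<^sup>*\<^sup>* x y" if "(\<lambda>x y. E x y \<and> x \<in> K \<and> y \<in> K)\<^sup>*\<^sup>* x y" "K \<subseteq> I \<union> J" for x y K
    using that(1) by (rule rtranclp_mono[THEN predicate2D, rotated]) (use that(2) in blast)
  have to_a: "?R\<^sup>*\<^sup>* x a" if "x \<in> I \<union> J" for x
  proof (cases "x \<in> I")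
    case True
    then show ?thesis using I ab(1) unfolding connected_in_def by (intro mono[of I]) auto
  next
    case False
    then have "?R\<^sup>*\<^sup>* x b" using that J ab(2) unfolding connected_in_def by (intro mono[of J]) auto
    then show ?thesis by (rule rtranclp.rtrancl_into_rtrancl) (use ab sym in blast)
  qed
  have "symp ?R" using sym by (auto intro!: sympI)
  then have "symp ?R\<^sup>*\<^sup>*" by (rule symp_rtranclp)
  with to_a show ?thesis unfolding connected_in_def by (meson rtranclp_trans sympD)
qed

lemma connected_in_insert:
  assumes "\<And>x y. E x y \<Longrightarrow> E y x" "connected_in E I" "touches E I x"
  shows "connected_in E (insert x I)"
  using connected_in_Un[where E = E, OF assms(1) _ assms(2), of "{x}" x] assms(3)
  unfolding touches_def by auto

lemma connected_in_walk:
  assumes sym: "\<And>x y. E x y \<Longrightarrow> E y x" and "successively E xs"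
  shows "connected_in E (set xs)"
  using assms(2)
proof (induction xs)
  case (Cons x xs)
  show ?case
  proof (cases xs)
    case Nil
    then show ?thesis by simp
  next
    case (Cons y ys)
    then have "connected_in E (set xs)" "touches E (set xs) x"
      using Cons.IH Cons.prems by (auto simp: touches_def)
    from connected_in_insert[OF sym this] show ?thesis by simp
  qed
qed simp

lemma rtranclp_distinct_walk:
  assumes "R\<^sup>*\<^sup>* x y"
  obtains xs where "xs \<noteq> []" "hd xs = x" "last xs = y" "distinct xs" "successively R xs"
  using assms
proof (induction arbitrary: thesis rule: converse_rtranclp_induct)
  case base
  show ?case by (rule base[of "[y]"]) auto
next
  case (step x z)
  obtain xs where xs: "xs \<noteq> []" "hd xs = z" "last xs = y" "distinct xs" "successively R xs"
    by (rule step.IH)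
  show ?case
  proof (cases "x \<in> set xs")
    case True
    then obtain as bs where "xs = as @ x # bs" by (meson split_list)
    then show ?thesis using xs by (intro step.prems[of "x # bs"]) (auto simp: successively_append_iff)
  next
    case False
    then show ?thesis using xs step.hyps
      by (intro step.prems[of "x # xs"]) (auto simp: successively_Cons)
  qed
qed

lemma rtranclp_sym:
  assumes "\<And>x y. R x y \<Longrightarrow> R y x" "R\<^sup>*\<^sup>* x y"
  shows "R\<^sup>*\<^sup>* y x"
proof -
  have "symp R" using assms(1) by (auto intro: sympI)
  from symp_rtranclp[OF this] assms(2) show ?thesis by (auto dest: sympD)
qed

lemma rtranclp_mem:
  assumes "R\<^sup>*\<^sup>* x y" "x \<in> S" "\<And>a b. R a b \<Longrightarrow> b \<in> S"
  shows "y \<in> S"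
  using assms by (induction rule: rtranclp_induct) auto

lemma successively_rtranclp:
  "successively R (x # xs) \<Longrightarrow> y \<in> set (x # xs) \<Longrightarrow> R\<^sup>*\<^sup>* x y"
proof (induction xs arbitrary: x)
  case (Cons z zs)
  then have "R x z" "y = x \<or> R\<^sup>*\<^sup>* z y" by auto
  then show ?case by (auto intro: converse_rtranclp_into_rtranclp)
qed auto

text \<open>\<open>no_theta\<close> excludes subdivisions of K_{2,3}. \<open>no_K4\<close> excludes
  subdivisions of K_4 in which \<open>u\<close> and \<open>v\<close> are branch vertices joined by a
  single edge; if their connecting path had an inner vertex, there would already be a theta. The set
  \<open>K\<close> supplies the link between \<open>I1\<close> and \<open>I2\<close> away from
  \<open>u\<close> and \<open>v\<close>.\<close>

locale outerplanar_relation =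
  fixes E :: "'a \<Rightarrow> 'a \<Rightarrow> bool"
  assumes sym: "E x y \<Longrightarrow> E y x" and irr: "\<not> E x x"
    and no_theta: "\<lbrakk>u \<noteq> v; \<And>I. I \<in> {I1, I2, I3} \<Longrightarrow>
        connected_in E I \<and> u \<notin> I \<and> v \<notin> I \<and> touches E I u \<and> touches E I v;
        I1 \<inter> I2 = {}; I1 \<inter> I3 = {}; I2 \<inter> I3 = {}\<rbrakk> \<Longrightarrow> False"
    and no_K4: "\<lbrakk>E u v; connected_in E K; u \<notin> K; v \<notin> K; I1 \<subseteq> K; I2 \<subseteq> K; I1 \<inter> I2 = {};
        \<And>I. I \<in> {I1, I2} \<Longrightarrow> connected_in E I \<and> touches E I u \<and> touches E I v\<rbrakk> \<Longrightarrow> False"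
begin

definition orderable :: "'a set \<Rightarrow> 'a \<Rightarrow> bool" where
  "orderable S u \<longleftrightarrow> (\<exists>xs. noncrossing E (u # xs) \<and> set (u # xs) = S)"

definition orderable_between :: "'a set \<Rightarrow> 'a \<Rightarrow> 'a \<Rightarrow> bool" where
  "orderable_between S u v \<longleftrightarrow> (\<exists>xs. noncrossing E (u # xs @ [v]) \<and> set (u # xs @ [v]) = S)"

text \<open>
  Either \<open>Z\<close> is a connection between \<open>u\<close> and \<open>v\<close> outside \<open>S\<close>, or the edge \<open>u v\<close> plays this role.
  In both cases \<open>u\<close> and \<open>v\<close> can be the two ends of a noncrossing order of \<open>S\<close>.
\<close>

definition outer_pair :: "'a set \<Rightarrow> 'a \<Rightarrow> 'a \<Rightarrow> 'a set \<Rightarrow> bool" where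
  "outer_pair S u v Z \<longleftrightarrow> u \<in> S \<and> v \<in> S \<and> u \<noteq> v \<and> Z \<inter> S = {} \<and>
     (connected_in E Z \<and> touches E Z u \<and> touches E Z v \<or>
      Z = {} \<and> E u v \<and> connected_in E (S - {u, v}))"

lemma orderable_betweenD: "orderable_between S u v \<Longrightarrow> orderable S u"
  unfolding orderable_def orderable_between_def by blast

text \<open>A second route from \<open>u\<close> to \<open>v\<close> would first meet
  \<open>zs\<close> at some \<open>y\<close>. Then \<open>u\<close> and \<open>y\<close> are joined
  in three disjoint ways: by the start of that route, by \<open>w\<close> and the part of
  \<open>zs\<close> before \<open>y\<close>, and by the rest of \<open>zs\<close> up to
  \<open>v\<close> followed by \<open>Z\<close> or the edge \<open>u v\<close>.\<close>

lemma cut_vertex: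
  assumes pair: "outer_pair S u v Z"
    and w: "E u w" "w \<noteq> v" and zs: "\<forall>z\<in>set zs. \<not> (E u z \<and> z \<noteq> v)" "u \<notin> set zs"
      "distinct (w # zs)" "zs \<noteq> []" "last zs = v" "successively E (w # zs)" "set (w # zs) \<subseteq> S"
  shows "\<not> (\<lambda>a b. E a b \<and> a \<in> S - {w} \<and> b \<in> S - {w} \<and> {a, b} \<noteq> {u, v})\<^sup>*\<^sup>* u v"
    (is "\<not> ?G\<^sup>*\<^sup>* u v")
proof
  assume "?G\<^sup>*\<^sup>* u v"
  then obtain qs where qs: "qs \<noteq> []" "hd qs = u" "last qs = v" "distinct qs" "successively ?G qs"
    by (rule rtranclp_distinct_walk)
  have uv: "u \<noteq> v" and ZS: "Z \<inter> S = {}" "u \<in> S" "v \<in> S" using pair by (auto simp: outer_pair_def)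
  have "v \<in> set qs" "v \<in> set zs" using qs zs by (metis last_in_set)+
  then obtain as y bs where y: "qs = as @ y # bs" "y \<in> set zs" "\<forall>a\<in>set as. a \<notin> set zs"
    using split_list_first_prop[of qs "\<lambda>x. x \<in> set zs"] by blast
  from y(1) qs(2) y(2) zs(2) obtain as' where as: "as = u # as'" by (cases as) auto
  obtain zs1 zs2 where z12: "zs = zs1 @ y # zs2" using y(2) by (meson split_list)
  have sqs: "successively ?G (u # as' @ y # bs)" using qs(5) y(1) as by simp
  \<comment> \<open>Here the choice of \<open>w\<close> enters: the only possible neighbour of
    \<open>u\<close> in \<open>zs\<close> is \<open>v\<close>, and the edge \<open>u v\<close> is
    barred from \<open>?G\<close>.\<close>
  have "as' \<noteq> []"
  proof
    assume "as' = []"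
    then have "E u y" "{u, y} \<noteq> {u, v}" using sqs by auto
    then show False using zs(1) y(2) by auto
  qed
  then have G1: "successively ?G as'" "?G u (hd as')" "?G (last as') y"
    using sqs by (auto simp: successively_Cons successively_append_iff)
  have inG: "set as' \<subseteq> S - {w}"
  proof
    fix x assume "x \<in> set as'"
    then have "?G\<^sup>*\<^sup>* u x" using successively_rtranclp[OF sqs, of x] by simp
    then show "x \<in> S - {w}" by (rule rtranclp_mem) (use ZS(2) w(1) irr in auto)
  qed
  have 1: "connected_in E (set as')" "touches E (set as') u" "touches E (set as') y"
    "u \<notin> set as'" "y \<notin> set as'" "set as' \<inter> set (w # zs) = {}" "v \<notin> set as'"
  proof -
    have "successively E as'" using G1(1) by (rule successively_mono) auto
    then show "connected_in E (set as')" by (rule connected_in_walk[where E = E, rotated]) (rule sym)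
    show "touches E (set as') u" using G1(2) \<open>as' \<noteq> []\<close> unfolding touches_def by auto
    show "touches E (set as') y" using G1(3) \<open>as' \<noteq> []\<close> sym[of "last as'" y] last_in_set[of as']
      unfolding touches_def by blast
    show "u \<notin> set as'" "y \<notin> set as'" using qs(4) y(1) as by auto
    show "set as' \<inter> set (w # zs) = {}" "v \<notin> set as'" using inG y(3) as \<open>v \<in> set zs\<close> by auto
  qed
  have 2: "connected_in E (set (w # zs1))" "touches E (set (w # zs1)) u" "touches E (set (w # zs1)) y"
    "u \<notin> set (w # zs1)" "y \<notin> set (w # zs1)"
  proof -
    have s: "successively E ((w # zs1) @ y # zs2)" using zs(6) z12 by simp
    then have "successively E (w # zs1)" "E (last (w # zs1)) y"
      unfolding successively_append_iff by auto
    then show "connected_in E (set (w # zs1))" "touches E (set (w # zs1)) y"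
      using connected_in_walk[where E = E, OF sym] sym last_in_set[of "w # zs1"]
      unfolding touches_def by blast+
    show "touches E (set (w # zs1)) u" using w unfolding touches_def by auto
    show "u \<notin> set (w # zs1)" "y \<notin> set (w # zs1)" using zs(2,3) w irr z12 by auto
  qed
  have 12: "set as' \<inter> set (w # zs1) = {}" using 1(6) z12 by auto
  show False
  proof (cases "y = v")
    case True
    show False
    proof (cases "Z = {}")
      case False
      then have Z: "connected_in E Z" "touches E Z u" "touches E Z v"
        using pair by (auto simp: outer_pair_def)
      have "set (w # zs1) \<subseteq> S" "set as' \<subseteq> S" using zs(7) z12 inG by auto
      then show False
        using no_theta[OF uv, of "set as'" "set (w # zs1)" Z] 1 2 12 Z True ZS by blast
    next
      \<comment> \<open>The third connection is now the bare edge \<open>u v\<close>, without an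
        inner vertex for a theta. Connectedness of \<open>S - {u, v}\<close> links the other two
        connections and gives a K_4 instead.\<close>
      case Z: True
      then have "E u v" "connected_in E (S - {u, v})"
        using pair by (auto simp: outer_pair_def touches_def)
      moreover have "set as' \<subseteq> S - {u, v}" "set (w # zs1) \<subseteq> S - {u, v}"
        using inG 1 2 True zs(7) z12 by auto
      ultimately show False
        using no_K4[of u v "S - {u, v}" "set as'" "set (w # zs1)"] 1 2 12 True by blast
    qed
  next
    case False
    then have zs2: "zs2 \<noteq> []" "last zs2 = v" using zs(5) z12 by auto
    have vZ: "connected_in E (insert v Z)" "touches E (insert v Z) u"
      using pair connected_in_insert[where E = E, OF sym] by (auto simp: outer_pair_def touches_def)
    have s: "successively E (y # zs2)" using zs(6) z12 by (auto simp: successively_append_iff successively_Cons)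
    then have "connected_in E (set zs2)" "E y (hd zs2)"
      using zs2 connected_in_walk[where E = E, OF sym] by (auto simp: successively_Cons)
    then have c2: "connected_in E (set zs2)" "touches E (set zs2) y"
      using zs2(1) unfolding touches_def by auto
    have "v \<in> set zs2" using zs2 last_in_set by blast
    have "connected_in E (set zs2 \<union> insert v Z)"
    proof (cases "Z = {}")
      case True
      then show ?thesis using c2 \<open>v \<in> set zs2\<close> by (simp add: insert_absorb)
    next
      case False
      then have "connected_in E Z" "touches E Z v" using pair by (auto simp: outer_pair_def)
      then obtain z where "z \<in> Z" "E v z" by (auto simp: touches_def)
      then have "connected_in E (set zs2 \<union> Z)"
        using connected_in_Un[where E = E, OF sym c2(1) \<open>connected_in E Z\<close> \<open>v \<in> set zs2\<close>] by blast
      then show ?thesis using \<open>v \<in> set zs2\<close> by (simp add: insert_absorb)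
    qed
    moreover have "touches E (set zs2 \<union> insert v Z) u" "touches E (set zs2 \<union> insert v Z) y"
      using c2(2) vZ(2) by (auto intro: touches_mono)
    moreover have "u \<notin> set zs2 \<union> insert v Z" "y \<notin> set zs2 \<union> insert v Z"
      "set as' \<inter> (set zs2 \<union> insert v Z) = {}" "set (w # zs1) \<inter> (set zs2 \<union> insert v Z) = {}"
      using zs(2,3,7) z12 ZS uv False 1(6,7) inG w(2) zs(5) zs2 \<open>v \<in> set zs2\<close> by auto
    ultimately show False
      using no_theta[of u y "set as'" "set (w # zs1)" "set zs2 \<union> insert v Z"] 1 2 12 y(2) zs(2)
      by blast
  qed
qed

end

section \<open>Building the order by splitting at cut vertices and 2-cuts\<close>

context outerplanar_relation begin

lemma reachable_side:
  assumes "\<And>a b. R a b \<Longrightarrow> a \<in> S \<and> b \<in> S" "\<And>a b. R a b \<Longrightarrow> R b a" "v \<in> S" "\<not> R\<^sup>*\<^sup>* u v"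
  shows "Collect (R\<^sup>*\<^sup>* v) \<subseteq> S" "u \<notin> Collect (R\<^sup>*\<^sup>* v)" "v \<in> Collect (R\<^sup>*\<^sup>* v)"
    "x \<notin> Collect (R\<^sup>*\<^sup>* v) \<Longrightarrow> y \<in> Collect (R\<^sup>*\<^sup>* v) \<Longrightarrow> \<not> R x y"
proof -
  show "Collect (R\<^sup>*\<^sup>* v) \<subseteq> S"
  proof
    fix x assume "x \<in> Collect (R\<^sup>*\<^sup>* v)"
    then have "R\<^sup>*\<^sup>* v x" by simp
    then show "x \<in> S" by (rule rtranclp_mem) (use assms(1,3) in auto)
  qed
  show "u \<notin> Collect (R\<^sup>*\<^sup>* v)"
  proof
    assume "u \<in> Collect (R\<^sup>*\<^sup>* v)"
    then have "R\<^sup>*\<^sup>* v u" by simp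
    then have "R\<^sup>*\<^sup>* u v" by (rule rtranclp_sym[rotated]) (rule assms(2))
    with assms(4) show False by simp
  qed
  show "\<not> R x y" if "x \<notin> Collect (R\<^sup>*\<^sup>* v)" "y \<in> Collect (R\<^sup>*\<^sup>* v)"
    using that assms(2)[of x y] rtranclp.rtrancl_into_rtrancl[of R v y x] by auto
qed simp

text \<open>
  If \<open>u\<close> reaches \<open>v\<close> in \<open>S\<close> without the edge \<open>u v\<close>, the last neighbour \<open>w\<close> of \<open>u\<close> on a path to \<open>v\<close> is a
  cut vertex, and each of the two parts, with the other one added to \<open>Z\<close>, is again such a pair.
\<close>

lemma orderable_between_step:
  assumes pair: "outer_pair S u v Z"
    and IH1: "\<And>T x. T \<subset> S \<Longrightarrow> x \<in> T \<Longrightarrow> orderable T x"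
    and IH2: "\<And>T x y Z. T \<subset> S \<Longrightarrow> outer_pair T x y Z \<Longrightarrow> orderable_between T x y"
  shows "orderable_between S u v"
proof -
  have uv: "u \<noteq> v" "u \<in> S" "v \<in> S" and ZS: "Z \<inter> S = {}" using pair by (auto simp: outer_pair_def)
  define F where "F a b \<longleftrightarrow> E a b \<and> a \<in> S \<and> b \<in> S \<and> {a, b} \<noteq> {u, v}" for a b
  have F: "a \<in> S \<and> b \<in> S" "F b a" if "F a b" for a b
    using that sym[of a b] unfolding F_def by (auto simp: doubleton_eq_iff)
  show ?thesis
  proof (cases "F\<^sup>*\<^sup>* u v")
    case False
    \<comment> \<open>The edge \<open>u v\<close> is the only possible link between \<open>B\<close>
      and the rest, so the orders of both are concatenated with \<open>u\<close> first and
      \<open>v\<close> last.\<close>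
    define B where "B = Collect (F\<^sup>*\<^sup>* v)"
    have B: "B \<subseteq> S" "u \<notin> B" "v \<in> B" "\<And>x y. x \<notin> B \<Longrightarrow> y \<in> B \<Longrightarrow> \<not> F x y"
      unfolding B_def using reachable_side[of F S v u] F uv(3) False by blast+
    obtain xs where xs: "noncrossing E (u # xs)" "set (u # xs) = S - B"
      using IH1[of "S - B" u] B uv unfolding orderable_def by blast
    obtain ys where ys: "noncrossing E (v # ys)" "set (v # ys) = B"
      using IH1[of B v] B uv unfolding orderable_def by blast
    have "noncrossing E (rev ys @ [v])" using noncrossing_rev[where E = E, OF sym ys(1)] by simp
    moreover have "x = u \<and> y = v" if "x \<in> S - B" "y \<in> B" "E x y" for x y
      using B(4)[of x y] that B(1,2,3) unfolding F_def by (auto simp: doubleton_eq_iff)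
    ultimately have "noncrossing E (u # xs @ rev ys @ [v])"
      using xs ys by (intro noncrossing_link[where E = E]) auto
    moreover have "set (u # xs @ rev ys @ [v]) = S" using xs(2) ys(2) B(1) by auto
    ultimately show ?thesis
      unfolding orderable_between_def by (intro exI[of _ "xs @ rev ys"]) simp
  next
    case True
    then obtain qs where qs: "qs \<noteq> []" "hd qs = u" "last qs = v" "distinct qs" "successively F qs"
      by (rule rtranclp_distinct_walk)
    have "\<exists>x\<in>set qs. E u x \<and> x \<noteq> v"
    proof -
      obtain r rs where "qs = u # r # rs"
        using qs(1-3) uv(1) by (cases qs; cases "tl qs") auto
      then have "F u r" using qs(5) by simp
      then show ?thesis using \<open>qs = u # r # rs\<close> unfolding F_def by auto
    qed
    then obtain ps w zs where split: "qs = ps @ w # zs" and w: "E u w" "w \<noteq> v"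
      and zs: "\<forall>z\<in>set zs. \<not> (E u z \<and> z \<noteq> v)"
      using split_list_last_prop[of qs "\<lambda>x. E u x \<and> x \<noteq> v"] by blast
    have "w \<noteq> u" using w irr by blast
    have ps: "ps \<noteq> []" "hd ps = u" using split qs(2) \<open>w \<noteq> u\<close> by (cases ps; simp)+
    have u: "u \<notin> set zs" using qs(4) split ps hd_in_set[OF ps(1)] by auto
    have zs': "zs \<noteq> []" "last zs = v" using split qs(3) w(2) by auto
    have s: "successively F (w # zs)" using qs(5) split by (simp add: successively_append_iff)
    have sE: "successively E (w # zs)" using s by (rule successively_mono) (simp add: F_def)
    have wS: "set (w # zs) \<subseteq> S"
    proof
      fix x assume "x \<in> set (w # zs)"
      then have "x \<in> set qs" using split by auto
      moreover have "qs = u # tl qs" using qs(1,2) by (cases qs) simp_all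
      ultimately have "F\<^sup>*\<^sup>* u x" using successively_rtranclp[of F u "tl qs" x] qs(5) by metis
      then show "x \<in> S" by (rule rtranclp_mem) (use uv F(1) in auto)
    qed
    define G where "G a b \<longleftrightarrow> E a b \<and> a \<in> S - {w} \<and> b \<in> S - {w} \<and> {a, b} \<noteq> {u, v}" for a b
    have "distinct (w # zs)" using qs(4) split by simp
    from cut_vertex[OF pair w zs u this zs' sE wS] have "\<not> G\<^sup>*\<^sup>* u v"
      unfolding G_def[abs_def] .
    moreover have G: "a \<in> S - {w} \<and> b \<in> S - {w}" "G b a" if "G a b" for a b
      using that sym[of a b] unfolding G_def by (auto simp: doubleton_eq_iff)
    define B where "B = Collect (G\<^sup>*\<^sup>* v)"
    ultimately have B: "B \<subseteq> S - {w}" "u \<notin> B" "v \<in> B" "\<And>x y. x \<notin> B \<Longrightarrow> y \<in> B \<Longrightarrow> \<not> G x y"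
      unfolding B_def using reachable_side[of G "S - {w}" v u] G uv(3) w(2) by blast+
    have zsB: "set zs \<subseteq> B"
    proof
      fix x assume x: "x \<in> set zs"
      have "w \<notin> set zs" using qs(4) split by simp
      have "successively F zs" using s by (auto simp: successively_Cons)
      then have "successively G zs"
        by (rule successively_mono) (use \<open>w \<notin> set zs\<close> in \<open>auto simp: F_def G_def\<close>)
      then have "successively (\<lambda>a b. G b a) zs" by (rule successively_mono) (use G in auto)
      then have "successively G (rev zs)" by simp
      moreover obtain rs where "rev zs = v # rs" using zs' by (cases zs rule: rev_cases) auto
      ultimately have "G\<^sup>*\<^sup>* v x" using successively_rtranclp[of G v rs x] x by (metis set_rev)
      then show "x \<in> B" unfolding B_def by simp
    qed
    let ?S1 = "S - B" and ?S2 = "insert w B"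
    have edge: "x = u \<and> y = v" if "x \<in> ?S1 - {w}" "y \<in> B" "E x y" for x y
      using B(4)[of x y] that B(1,2,3) unfolding G_def by (auto simp: doubleton_eq_iff)
    have wS': "w \<in> S" using wS by simp
    \<comment> \<open>Outside the piece containing \<open>u\<close> and \<open>w\<close>, these two
      are joined along \<open>zs\<close> to \<open>v\<close> and from there through \<open>Z\<close>
      or the edge \<open>u v\<close>.\<close>
    have "connected_in E (set zs \<union> Z) \<and> touches E (set zs \<union> Z) u"
    proof (cases "Z = {}")
      case True
      then have "E u v" using pair by (auto simp: outer_pair_def touches_def)
      then show ?thesis using True zs' sE last_in_set[OF zs'(1)]
          connected_in_walk[where E = E, OF sym, of zs]
        by (auto simp: successively_Cons touches_def)
    next
      case False
      then have Z: "connected_in E Z" "touches E Z u" "touches E Z v"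
        using pair by (auto simp: outer_pair_def)
      then obtain z where "z \<in> Z" "E v z" by (auto simp: touches_def)
      moreover have "connected_in E (set zs)" "v \<in> set zs"
        using sE zs' last_in_set[OF zs'(1)] connected_in_walk[where E = E, OF sym, of zs]
        by (auto simp: successively_Cons)
      ultimately have "connected_in E (set zs \<union> Z)"
        using connected_in_Un[where E = E, OF sym _ Z(1), of "set zs" v z] by blast
      then show ?thesis using Z(2) by (auto intro: touches_mono)
    qed
    moreover have "touches E (set zs \<union> Z) w"
      using sE zs'(1) by (auto simp: successively_Cons touches_def intro!: bexI[of _ "hd zs"])
    ultimately have "outer_pair ?S1 u w (set zs \<union> Z)"
      unfolding outer_pair_def using uv B \<open>w \<noteq> u\<close> wS' ZS zsB by auto
    then have "orderable_between ?S1 u w" using IH2[of ?S1 u w] B uv by blast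
    then obtain xs where xs: "noncrossing E (u # xs @ [w])" "set (u # xs @ [w]) = ?S1"
      unfolding orderable_between_def by blast
    \<comment> \<open>Outside the piece containing \<open>w\<close> and \<open>v\<close>, the
      connection runs from \<open>w\<close> to \<open>u\<close> and on through \<open>Z\<close> or
      the edge \<open>u v\<close>.\<close>
    have "connected_in E (insert u Z) \<and> touches E (insert u Z) v"
      using pair connected_in_insert[where E = E, OF sym, of Z u] sym[of u v]
      by (auto simp: outer_pair_def touches_def)
    moreover have "touches E (insert u Z) w" using sym[OF w(1)] by (auto simp: touches_def)
    ultimately have "outer_pair ?S2 w v (insert u Z)"
      unfolding outer_pair_def using uv B \<open>w \<noteq> u\<close> w(2) wS' ZS by auto
    moreover have "?S2 \<subset> S" using B uv \<open>w \<noteq> u\<close> wS' by auto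
    ultimately have "orderable_between ?S2 w v" using IH2 by blast
    then obtain ys where ys: "noncrossing E (w # ys @ [v])" "set (w # ys @ [v]) = ?S2"
      unfolding orderable_between_def by blast
    have dist: "w \<notin> set (u # xs)" "w \<notin> set (ys @ [v])"
      using noncrossing_distinct[OF xs(1)] noncrossing_distinct[OF ys(1)] by auto
    have sx: "set (u # xs) = ?S1 - {w}" and sy: "set (ys @ [v]) = B"
      using xs(2) ys(2) dist B(1) by auto
    have "noncrossing E (u # xs @ w # ys @ [v])"
    proof (rule noncrossing_join[where E = E, OF sym xs(1) ys(1)])
      show "set (u # xs) \<inter> set (ys @ [v]) = {}" unfolding sx sy by blast
      show "x = u \<and> y = v" if "x \<in> set (u # xs)" "y \<in> set (ys @ [v])" "E x y" for x y
        using that edge unfolding sx sy by blast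
    qed
    moreover have "set (u # xs @ w # ys @ [v]) = S" using xs(2) ys(2) B(1) wS' by auto
    ultimately show ?thesis
      unfolding orderable_between_def by (intro exI[of _ "xs @ w # ys"]) simp
  qed
qed

text \<open>An edge \<open>u v\<close> whose removal with its ends disconnects the rest may be a
  chord, so a component \<open>A\<close> of the rest is split off. If \<open>A\<close> touches both
  ends, then \<open>A\<close> is the outside connection for \<open>S - A\<close>, and the edge
  serves for \<open>A\<close> with both ends; otherwise \<open>A\<close> can be attached at a single
  vertex. \<open>IH2\<close> admits \<open>T = S\<close> because pairs are settled before single
  vertices.\<close>

lemma orderable_step:
  assumes u: "u \<in> S"
    and IH1: "\<And>T x. T \<subset> S \<Longrightarrow> x \<in> T \<Longrightarrow> orderable T x"
    and IH2: "\<And>T x y Z. T \<subseteq> S \<Longrightarrow> outer_pair T x y Z \<Longrightarrow> orderable_between T x y"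
  shows "orderable S u"
proof (cases "\<exists>v\<in>S. E u v")
  case False
  show ?thesis
  proof (cases "S = {u}")
    case True
    then show ?thesis unfolding orderable_def by (intro exI[of _ "[]"]) simp
  next
    case nS: False
    then obtain x where "x \<in> S" "x \<noteq> u" using u by auto
    then have "orderable (S - {u}) x" using u by (intro IH1) auto
    then obtain xs where xs: "noncrossing E (x # xs)" "set (x # xs) = S - {u}"
      unfolding orderable_def by blast
    have "noncrossing E ([u] @ x # xs)"
    proof (rule noncrossing_append[OF noncrossing_singleton xs(1)])
      show "set [u] \<inter> set (x # xs) = {}" using xs(2) by simp
      show "\<not> E a b" if "a \<in> set [u]" "b \<in> set (x # xs)" for a b
        using that False unfolding xs(2) by auto
    qed
    then show ?thesis unfolding orderable_def using xs(2) u by (intro exI[of _ "x # xs"]) auto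
  qed
next
  case True
  then obtain v where v: "v \<in> S" "E u v" by blast
  have uv: "u \<noteq> v" using v irr by blast
  show ?thesis
  proof (cases "connected_in E (S - {u, v})")
    case True
    then have "outer_pair S u v {}" unfolding outer_pair_def using u v uv by auto
    then show ?thesis using IH2[of S u v "{}"] orderable_betweenD by blast
  next
    case False
    let ?K = "S - {u, v}"
    define R where "R x y \<longleftrightarrow> E x y \<and> x \<in> ?K \<and> y \<in> ?K" for x y
    have R: "x \<in> ?K \<and> y \<in> ?K" "R y x" if "R x y" for x y using that sym unfolding R_def by blast+
    obtain b a where ab: "a \<in> ?K" "b \<in> ?K" "\<not> R\<^sup>*\<^sup>* b a"
      using False unfolding connected_in_def R_def by blast
    define A where "A = Collect (R\<^sup>*\<^sup>* a)"
    have A: "A \<subseteq> ?K" "b \<notin> A" "a \<in> A" "\<And>x y. x \<notin> A \<Longrightarrow> y \<in> A \<Longrightarrow> \<not> R x y"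
      unfolding A_def using reachable_side[of R ?K a b] R ab by blast+
    have noE: "\<not> E x y" "\<not> E y x" if "x \<in> ?K - A" "y \<in> A" for x y
      using A(1) A(4)[of x y] that sym[of y x] unfolding R_def by blast+
    have conA: "connected_in E A"
    proof -
      have into: "(\<lambda>x y. E x y \<and> x \<in> A \<and> y \<in> A)\<^sup>*\<^sup>* a x" if "R\<^sup>*\<^sup>* a x" for x
        using that
      proof (induction rule: rtranclp_induct)
        case (step y z)
        then have "y \<in> A" "z \<in> A" unfolding A_def by (auto intro: rtranclp.rtrancl_into_rtrancl)
        then show ?case using step unfolding R_def by (auto intro: rtranclp.rtrancl_into_rtrancl)
      qed simp
      let ?R = "\<lambda>x y. E x y \<and> x \<in> A \<and> y \<in> A"
      have "?R\<^sup>*\<^sup>* x y" if "x \<in> A" "y \<in> A" for x y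
      proof -
        have "?R\<^sup>*\<^sup>* a x" "?R\<^sup>*\<^sup>* a y" using into that unfolding A_def by simp_all
        moreover have "?R\<^sup>*\<^sup>* x a"
          by (rule rtranclp_sym[OF _ \<open>?R\<^sup>*\<^sup>* a x\<close>]) (use sym in blast)
        ultimately show ?thesis by (meson rtranclp_trans)
      qed
      then show ?thesis unfolding connected_in_def by blast
    qed
    consider "touches E A u" "touches E A v" | "\<not> touches E A v" | "\<not> touches E A u" by blast
    then show ?thesis
    proof cases
      case 1
      have "outer_pair (S - A) u v A" unfolding outer_pair_def using u v uv A conA 1 by auto
      then have "orderable_between (S - A) u v" using IH2 by blast
      then obtain xs where xs: "noncrossing E (u # xs @ [v])" "set (u # xs @ [v]) = S - A"
        unfolding orderable_between_def by blast
      have "A \<union> {u, v} - {u, v} = A" using A(1) by auto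
      then have "outer_pair (A \<union> {u, v}) u v {}" unfolding outer_pair_def using v uv conA by auto
      moreover have "A \<union> {u, v} \<subseteq> S" using A(1) u v by blast
      ultimately have "orderable_between (A \<union> {u, v}) u v" using IH2 by blast
      then obtain ys where ys: "noncrossing E (u # ys @ [v])" "set (u # ys @ [v]) = A \<union> {u, v}"
        unfolding orderable_between_def by blast
      have "u \<notin> set xs" "v \<notin> set xs" "u \<notin> set ys" "v \<notin> set ys"
        using noncrossing_distinct[OF xs(1)] noncrossing_distinct[OF ys(1)] by auto
      then have sx: "set xs = ?K - A" and sy: "set ys = A" using xs(2) ys(2) A(1) by auto
      have "noncrossing E (u # xs @ v # rev ys)"
        by (rule noncrossing_glue[where E = E, OF sym xs(1) ys(1)]) (use noE(1) in \<open>auto simp: sx sy\<close>)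
      moreover have "set (u # xs @ v # rev ys) = S" using sx sy A(1) u v by auto
      ultimately show ?thesis unfolding orderable_def by blast
    next
      case 2
      have "insert u A \<subset> S" using A ab u by auto
      then obtain as where as: "noncrossing E (u # as)" "set (u # as) = insert u A"
        using IH1[of "insert u A" u] unfolding orderable_def by blast
      have "S - A \<subset> S" "u \<in> S - A" using A ab u by auto
      then obtain bs where bs: "noncrossing E (u # bs)" "set (u # bs) = S - A"
        using IH1[of "S - A" u] unfolding orderable_def by blast
      have sa: "set as = A" and sb: "set bs = S - A - {u}"
        using noncrossing_distinct[OF as(1)] noncrossing_distinct[OF bs(1)] as(2) bs(2) A(1) by auto
      have no: "\<not> E x y" if "x \<in> A" "y \<in> S - A - {u}" for x y
        using noE(2)[of y x] 2 that sym[of x y] unfolding touches_def by blast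
      have "noncrossing E (u # as @ bs)"
        by (rule noncrossing_wedge[OF as(1) bs(1)]) (use no in \<open>auto simp: sa sb\<close>)
      moreover have "set (u # as @ bs) = S" using sa sb A(1) u by auto
      ultimately show ?thesis unfolding orderable_def by blast
    next
      case 3
      have "insert v A \<subset> S" using A ab v by auto
      then obtain as where as: "noncrossing E (v # as)" "set (v # as) = insert v A"
        using IH1[of "insert v A" v] unfolding orderable_def by blast
      have "S - A \<subset> S" "u \<in> S - A" using A ab u by auto
      then obtain bs where bs: "noncrossing E (u # bs)" "set (u # bs) = S - A"
        using IH1[of "S - A" u] unfolding orderable_def by blast
      have "v \<in> set bs" using bs(2) v uv A(1) by auto
      then obtain us vs where split: "bs = us @ v # vs" by (meson split_list)
      have sa: "set as = A" and sb: "set ((u # us) @ vs) = S - A - {v}"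
        using noncrossing_distinct[OF as(1)] noncrossing_distinct[OF bs(1)] as(2) bs(2) A(1) uv
        by (auto simp: split)
      have no: "\<not> E x y" if "x \<in> A" "y \<in> S - A - {v}" for x y
        using noE(2)[of y x] 3 that sym[of x y] unfolding touches_def by blast
      have "noncrossing E ((u # us) @ v # as @ vs)"
      proof (rule noncrossing_insert[where E = E, OF sym])
        show "noncrossing E ((u # us) @ v # vs)" using bs(1) split by simp
        show "set as \<inter> set ((u # us) @ vs) = {}" unfolding sa sb by blast
        show "\<not> E x y" if "x \<in> set as" "y \<in> set ((u # us) @ vs)" for x y
          using no that unfolding sa sb by blast
      qed ((assumption | rule as(1))+)
      moreover have "set ((u # us) @ v # as @ vs) = S" using sa bs(2) A(1) split by auto
      ultimately show ?thesis unfolding orderable_def by (metis append_Cons)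
    qed
  qed
qed

text \<open>The induction must be joint: the statement for pairs in \<open>S\<close> uses both
  statements for proper subsets, and the one for single vertices also uses pairs in \<open>S\<close>
  itself.\<close>

lemma ex_orders:
  assumes "finite S"
  shows "(\<forall>u v Z. outer_pair S u v Z \<longrightarrow> orderable_between S u v) \<and> (\<forall>u\<in>S. orderable S u)"
  using assms
proof (induction rule: finite_psubset_induct)
  case (psubset S)
  have IH1: "orderable T x" if "T \<subset> S" "x \<in> T" for T x
    using psubset.IH[OF that(1)] that(2) by simp
  have IH2: "orderable_between T x y" if "T \<subset> S" "outer_pair T x y Z" for T x y Z
    using psubset.IH[OF that(1)] that(2) by blast
  have between: "orderable_between S x y" if "outer_pair S x y Z" for x y Z
    using that IH1 IH2 by (rule orderable_between_step)
  have "orderable S u" if "u \<in> S" for u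
    using that IH1
  proof (rule orderable_step)
    show "orderable_between T x y" if "T \<subseteq> S" "outer_pair T x y Z" for T x y Z
      using that between IH2 by (cases "T = S") auto
  qed
  then show ?case using between by simp
qed

theorem ex_noncrossing_order:
  assumes "finite S"
  shows "\<exists>xs. noncrossing E xs \<and> set xs = S"
proof (cases "S = {}")
  case True
  then show ?thesis by (intro exI[of _ "[]"]) simp
next
  case False
  then obtain u where "u \<in> S" by blast
  then have "orderable S u" using ex_orders[OF assms] by simp
  then show ?thesis unfolding orderable_def by metis
qed

end

section \<open>Theta curves\<close>

definition theta_arcs :: "complex \<Rightarrow> complex \<Rightarrow> (real \<Rightarrow> complex) \<Rightarrow> (real \<Rightarrow> complex) \<Rightarrow> bool" where
  "theta_arcs a b g h \<longleftrightarrow> arc g \<and> arc h \<and> pathstart g = a \<and> pathfinish g = b \<and>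
     pathstart h = a \<and> pathfinish h = b \<and> path_image g \<inter> path_image h = {a, b}"

lemma theta_arcs_Jordan:
  assumes "theta_arcs a b g h"
  shows "inside (path_image g \<union> path_image h) \<noteq> {}"
    "open (inside (path_image g \<union> path_image h))"
    "connected (inside (path_image g \<union> path_image h))"
    "open (outside (path_image g \<union> path_image h))"
    "connected (outside (path_image g \<union> path_image h))"
    "frontier (inside (path_image g \<union> path_image h)) = path_image g \<union> path_image h"
proof -
  have "simple_path (g +++ reversepath h)" "pathfinish (g +++ reversepath h) = pathstart (g +++ reversepath h)"
    "path_image (g +++ reversepath h) = path_image g \<union> path_image h"
    using assms by (simp_all add: theta_arcs_def simple_path_join_loop_eq arc_reversepath path_image_join)
  from Jordan_inside_outside[OF this(1,2)] this(3) show
    "inside (path_image g \<union> path_image h) \<noteq> {}"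
    "open (inside (path_image g \<union> path_image h))"
    "connected (inside (path_image g \<union> path_image h))"
    "open (outside (path_image g \<union> path_image h))"
    "connected (outside (path_image g \<union> path_image h))"
    "frontier (inside (path_image g \<union> path_image h)) = path_image g \<union> path_image h"
    by simp_all
qed

lemma connected_inside_or_outside:
  fixes S :: "'a::real_normed_vector set"
  assumes "closed S" "connected T" "T \<inter> S = {}"
  shows "T \<subseteq> inside S \<or> T \<subseteq> outside S"
proof (rule ccontr)
  assume *: "\<not> ?thesis"
  have T: "T \<subseteq> inside S \<union> outside S" using assms(3) by auto
  have "inside S \<inter> T \<noteq> {}" "outside S \<inter> T \<noteq> {}" using * T by blast+
  then show False
    using connectedD[OF assms(2) open_inside[OF assms(1)] open_outside[OF assms(1)]] T
    by (metis Int_empty_left inside_Int_outside)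
qed

lemma connected_component_outside:
  assumes "connected (outside S)" "x \<in> outside S" "y \<in> outside S"
  shows "connected_component (- S) x y"
proof -
  have "outside S \<subseteq> - S" using outside_no_overlap[of S] by blast
  then show ?thesis using assms unfolding connected_component_def by blast
qed

text \<open>If none of the arcs lay inside the curve formed by the other two, then the inside of
  \<open>g2 \<union> g3\<close> would be outside both \<open>g1 \<union> g2\<close> and \<open>g1 \<union> g3\<close>, whose intersection \<open>g1\<close> is connected;
  Janiszewski's theorem then joins it to infinity in the complement of \<open>g1 \<union> g2 \<union> g3\<close>.\<close>

lemma theta_inside:
  assumes g12: "theta_arcs a b g1 g2" and g13: "theta_arcs a b g1 g3" and g23: "theta_arcs a b g2 g3"
  shows "path_image g1 - {a, b} \<subseteq> inside (path_image g2 \<union> path_image g3) \<or>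
         path_image g2 - {a, b} \<subseteq> inside (path_image g1 \<union> path_image g3) \<or>
         path_image g3 - {a, b} \<subseteq> inside (path_image g1 \<union> path_image g2)"
proof (rule ccontr)
  define P1 P2 P3 where P: "P1 = path_image g1" "P2 = path_image g2" "P3 = path_image g3"
  assume "\<not> ?thesis"
  then have not: "\<not> P1 - {a, b} \<subseteq> inside (P2 \<union> P3)" "\<not> P2 - {a, b} \<subseteq> inside (P1 \<union> P3)"
    "\<not> P3 - {a, b} \<subseteq> inside (P1 \<union> P2)"
    unfolding P by auto
  have arcs: "arc g1" "arc g2" "arc g3" using assms by (auto simp: theta_arcs_def)
  have ab: "a \<in> P1" "b \<in> P1" "a \<in> P2" "b \<in> P2" "a \<in> P3" "b \<in> P3"
    and int: "P1 \<inter> P2 = {a, b}" "P1 \<inter> P3 = {a, b}" "P2 \<inter> P3 = {a, b}"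
    using assms unfolding P theta_arcs_def by auto
  have con: "connected (P1 - {a, b})" "connected (P2 - {a, b})" "connected (P3 - {a, b})"
    using connected_simple_path_endless[OF arc_imp_simple_path] arcs assms
    unfolding P theta_arcs_def by metis+
  have cpt: "compact P1" "compact P2" "compact P3" unfolding P using arcs by (simp_all add: compact_arc_image)
  then have closed: "closed (P2 \<union> P3)" "closed (P1 \<union> P3)" "closed (P1 \<union> P2)"
    by (simp_all add: compact_imp_closed closed_Un)
  have "P1 - {a, b} \<subseteq> outside (P2 \<union> P3)"
    using connected_inside_or_outside[OF closed(1) con(1)] not(1) int by auto
  then have d1: "P1 \<inter> inside (P2 \<union> P3) = {}"
    using ab inside_Int_outside[of "P2 \<union> P3"] inside_no_overlap[of "P2 \<union> P3"] by blast
  have "P2 - {a, b} \<subseteq> outside (P1 \<union> P3)"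
    using connected_inside_or_outside[OF closed(2) con(2)] not(2) int by auto
  then have d2: "(P2 - {a, b}) \<inter> inside (P1 \<union> P3) = {}"
    using inside_Int_outside[of "P1 \<union> P3"] by blast
  have "P3 - {a, b} \<subseteq> outside (P1 \<union> P2)"
    using connected_inside_or_outside[OF closed(3) con(3)] not(3) int by auto
  then have d3: "(P3 - {a, b}) \<inter> inside (P1 \<union> P2) = {}"
    using inside_Int_outside[of "P1 \<union> P2"] by blast
  have J: "inside (P2 \<union> P3) \<noteq> {}" "connected (inside (P2 \<union> P3))" "frontier (inside (P2 \<union> P3)) = P2 \<union> P3"
    using theta_arcs_Jordan[OF g23] unfolding P by simp_all
  have front: "P2 \<union> P3 \<subseteq> closure (inside (P2 \<union> P3))"
    using J(3) unfolding frontier_def by blast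
  have ne: "P2 - {a, b} \<noteq> {}" "P3 - {a, b} \<noteq> {}"
    using nonempty_simple_path_endless[OF arc_imp_simple_path] arcs assms
    unfolding P theta_arcs_def by metis+
  \<comment> \<open>Otherwise, on passing to closures, the boundary arc \<open>P3\<close> would lie
    in \<open>P1 \<union> P2 \<union> inside (P1 \<union> P2)\<close>, and its points other than
    \<open>a\<close> and \<open>b\<close> would be inside.\<close>
  have out12: "inside (P2 \<union> P3) \<subseteq> outside (P1 \<union> P2)"
  proof (rule ccontr)
    assume "\<not> ?thesis"
    then have "inside (P2 \<union> P3) \<subseteq> inside (P1 \<union> P2)"
      using connected_inside_or_outside[OF closed(3) J(2)] d1 inside_no_overlap[of "P2 \<union> P3"] by blast
    then have "closure (inside (P2 \<union> P3)) \<subseteq> P1 \<union> P2 \<union> inside (P1 \<union> P2)"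
      using closure_inside_subset[OF closed(3)] closure_mono by blast
    then have "P3 \<subseteq> P1 \<union> P2 \<union> inside (P1 \<union> P2)" using front by blast
    moreover obtain z where "z \<in> P3 - {a, b}" using ne(2) by blast
    moreover from this have "z \<notin> P1 \<union> P2" using int(2,3) by blast
    ultimately have "z \<in> (P3 - {a, b}) \<inter> inside (P1 \<union> P2)" by blast
    then show False unfolding d3 by simp
  qed
  have out13: "inside (P2 \<union> P3) \<subseteq> outside (P1 \<union> P3)"
  proof (rule ccontr)
    assume "\<not> ?thesis"
    then have "inside (P2 \<union> P3) \<subseteq> inside (P1 \<union> P3)"
      using connected_inside_or_outside[OF closed(2) J(2)] d1 inside_no_overlap[of "P2 \<union> P3"] by blast
    then have "closure (inside (P2 \<union> P3)) \<subseteq> P1 \<union> P3 \<union> inside (P1 \<union> P3)"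
      using closure_inside_subset[OF closed(2)] closure_mono by blast
    then have "P2 \<subseteq> P1 \<union> P3 \<union> inside (P1 \<union> P3)" using front by blast
    moreover obtain z where "z \<in> P2 - {a, b}" using ne(1) by blast
    moreover from this have "z \<notin> P1 \<union> P3" using int(1,3) by blast
    ultimately have "z \<in> (P2 - {a, b}) \<inter> inside (P1 \<union> P3)" by blast
    then show False unfolding d2 by simp
  qed
  obtain x where x: "x \<in> inside (P2 \<union> P3)" using J(1) by blast
  have "bounded (P1 \<union> P2 \<union> P3)" using cpt by (simp add: compact_imp_bounded)
  then obtain y where y: "y \<in> outside (P1 \<union> P2 \<union> P3)"
    using outside_bounded_nonempty by blast
  have "outside (P1 \<union> P2 \<union> P3) \<subseteq> outside (P1 \<union> P2)" "outside (P1 \<union> P2 \<union> P3) \<subseteq> outside (P1 \<union> P3)"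
    "outside (P1 \<union> P2 \<union> P3) \<subseteq> outside (P2 \<union> P3)"
    by (rule outside_mono; blast)+
  then have yo: "y \<in> outside (P1 \<union> P2)" "y \<in> outside (P1 \<union> P3)" "y \<in> outside (P2 \<union> P3)"
    using y by blast+
  have "connected_component (- (P1 \<union> P2)) x y"
    using theta_arcs_Jordan(5)[OF g12] out12 x yo(1) unfolding P
    by (intro connected_component_outside) auto
  moreover have "connected_component (- (P1 \<union> P3)) x y"
    using theta_arcs_Jordan(5)[OF g13] out13 x yo(2) unfolding P
    by (intro connected_component_outside) auto
  moreover have "(P1 \<union> P2) \<inter> (P1 \<union> P3) = P1" using int ab by blast
  then have "connected ((P1 \<union> P2) \<inter> (P1 \<union> P3))"
    unfolding P using connected_arc_image[OF arcs(1)] by simp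
  ultimately have "connected_component (- ((P1 \<union> P2) \<union> (P1 \<union> P3))) x y"
    using Janiszewski[of "P1 \<union> P2" "P1 \<union> P3" x y] cpt closed(2) by (simp add: compact_Un)
  then have "connected_component (- (P2 \<union> P3)) x y"
    by (rule connected_component_of_subset) blast
  then have "y \<in> inside (P2 \<union> P3)" using inside_same_component x by blast
  then show False using yo(3) inside_Int_outside[of "P2 \<union> P3"] by blast
qed

text \<open>By continuity. It later locates the ends of an arc of which only the interior is known
  to lie in a region.\<close>

lemma arc_endpoints_in_closure:
  assumes "arc g"
  shows "pathstart g \<in> closure (path_image g - {pathstart g, pathfinish g})"
    "pathfinish g \<in> closure (path_image g - {pathstart g, pathfinish g})"
proof -
  let ?T = "closure (path_image g - {pathstart g, pathfinish g})"
  have "continuous_on (closure {0<..<1}) g" using assms by (simp add: arc_def path_def)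
  moreover have "g ` {0<..<1} \<subseteq> ?T"
    using assms closure_subset simple_path_endless[OF arc_imp_simple_path[OF assms]] by auto
  ultimately have "g ` closure {0<..<1} \<subseteq> ?T" by (intro image_closure_subset) auto
  then have "g ` {0..1} \<subseteq> ?T" by simp
  then show "pathstart g \<in> ?T" "pathfinish g \<in> ?T"
    by (auto simp: pathstart_def pathfinish_def)
qed

section \<open>Outerplanar drawings\<close>

fun path_edges :: "'a list \<Rightarrow> 'a set set" where
  "path_edges (x # y # ys) = insert {x, y} (path_edges (y # ys))"
| "path_edges _ = {}"

lemma path_edges_subset: "e \<in> path_edges xs \<Longrightarrow> e \<subseteq> set xs"
  by (induction xs rule: path_edges.induct) auto

lemma path_edges_walk: "successively E xs \<Longrightarrow> e \<in> path_edges xs \<Longrightarrow> \<exists>x y. e = {x, y} \<and> E x y"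
  by (induction xs rule: path_edges.induct) auto

lemma path_edges_append: "path_edges (xs @ x # ys) = path_edges (xs @ [x]) \<union> path_edges (x # ys)"
proof (induction xs)
  case (Cons a xs)
  then show ?case by (cases xs) auto
qed simp

lemma path_edges_rev: "path_edges (rev xs) = path_edges xs"
proof (induction xs rule: path_edges.induct)
  case (1 x y ys)
  have "path_edges (rev (x # y # ys)) = path_edges (rev ys @ [y]) \<union> path_edges [y, x]"
    using path_edges_append[of "rev ys" y "[x]"] by simp
  also have "path_edges (rev ys @ [y]) = path_edges (y # ys)" using 1 by simp
  finally show ?case by (simp add: insert_commute)
qed simp_all

lemma ends_edge_trivial:
  assumes "distinct (a # l @ [b])" "{a, b} \<in> path_edges (a # l @ [b])"
  shows "l = []"
proof (rule ccontr)
  assume "l \<noteq> []"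
  then obtain y ys where l: "l = y # ys" by (cases l) auto
  have "{a, b} \<noteq> {a, y}" using assms(1) l by (auto simp: doubleton_eq_iff)
  then have "{a, b} \<in> path_edges (y # ys @ [b])" using assms(2) l by simp
  from path_edges_subset[OF this] show False using assms(1) l by auto
qed

locale outerplanar_drawing =
  fixes E :: "'a \<Rightarrow> 'a \<Rightarrow> bool" and V :: "'a set" and p :: "'a \<Rightarrow> complex"
    and c :: "'a set \<Rightarrow> real \<Rightarrow> complex"
  assumes sym: "E x y \<Longrightarrow> E y x" and irr: "\<not> E x x" and ends: "E x y \<Longrightarrow> x \<in> V"
    and inj: "inj_on p V"
    and edge: "E x y \<Longrightarrow> arc (c {x, y}) \<and> {pathstart (c {x, y}), pathfinish (c {x, y})} = {p x, p y} \<and>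
      path_image (c {x, y}) \<inter> p ` V = {p x, p y}"
    and cross: "E x y \<Longrightarrow> E x' y' \<Longrightarrow> {x, y} \<noteq> {x', y'} \<Longrightarrow>
      path_image (c {x, y}) \<inter> path_image (c {x', y'}) \<subseteq> p ` ({x, y} \<inter> {x', y'})"
    and outer: "v \<in> V \<Longrightarrow>
      p v \<in> frontier (outside (p ` V \<union> (\<Union>e\<in>{{x, y} |x y. E x y}. path_image (c e))))"
begin

definition drawn :: "complex set" where
  "drawn = p ` V \<union> (\<Union>e\<in>{{x, y} |x y. E x y}. path_image (c e))"

definition curve :: "'a list \<Rightarrow> complex set" where
  "curve xs = p ` set xs \<union> (\<Union>e\<in>path_edges xs. path_image (c e))"

text \<open>The one place where incidence with the outer face enters: \<open>p v\<close> is a limit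
  of points outside \<open>S\<close>, whereas \<open>inside S\<close> is open and disjoint from
  \<open>outside S\<close>.\<close>

lemma not_inside:
  assumes "v \<in> V" "S \<subseteq> drawn" "closed S"
  shows "p v \<notin> inside S"
proof
  assume "p v \<in> inside S"
  have "p v \<in> closure (outside drawn)" using outer[OF assms(1)] unfolding drawn_def frontier_def by blast
  then have "p v \<in> closure (outside S)" using closure_mono[OF outside_mono[OF assms(2)]] by blast
  then have "inside S \<inter> outside S \<noteq> {}"
    using open_inside[OF assms(3)] \<open>p v \<in> inside S\<close> open_Int_closure_eq_empty by blast
  then show False by simp
qed

lemma curve_edge:
  assumes "E x y"
  shows "curve [x, y] = path_image (c {x, y})"
  using edge[OF assms] unfolding curve_def by auto

lemma curve_Int_vertices:
  assumes "successively E xs" "set xs \<subseteq> V"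
  shows "curve xs \<inter> p ` V = p ` set xs"
proof -
  have "path_image (c e) \<inter> p ` V \<subseteq> p ` set xs" if e: "e \<in> path_edges xs" for e
  proof -
    obtain x y where "e = {x, y}" "E x y" using path_edges_walk[OF assms(1) e] by blast
    then show ?thesis using edge[of x y] path_edges_subset[OF e] by auto
  qed
  then show ?thesis using assms(2) unfolding curve_def by blast
qed

lemma curve_Int:
  assumes xs: "successively E xs" "set xs \<subseteq> V" and ys: "successively E ys" "set ys \<subseteq> V"
    and disj: "path_edges xs \<inter> path_edges ys = {}"
  shows "curve xs \<inter> curve ys = p ` (set xs \<inter> set ys)"
proof
  have vert: "p ` set xs \<inter> p ` set ys = p ` (set xs \<inter> set ys)"
    using inj_on_image_Int[OF inj xs(2) ys(2)] by simp
  show "p ` (set xs \<inter> set ys) \<subseteq> curve xs \<inter> curve ys" unfolding curve_def by blast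
  show "curve xs \<inter> curve ys \<subseteq> p ` (set xs \<inter> set ys)"
  proof
    fix z assume z: "z \<in> curve xs \<inter> curve ys"
    show "z \<in> p ` (set xs \<inter> set ys)"
    proof (cases "z \<in> p ` V")
      case True
      then have "z \<in> p ` set xs" "z \<in> p ` set ys"
        using curve_Int_vertices[OF xs] curve_Int_vertices[OF ys] z by blast+
      then show ?thesis using vert by blast
    next
      case False
      then have "z \<notin> p ` set xs" "z \<notin> p ` set ys" using xs(2) ys(2) by blast+
      then obtain e f where e: "e \<in> path_edges xs" "z \<in> path_image (c e)"
        and f: "f \<in> path_edges ys" "z \<in> path_image (c f)"
        using z unfolding curve_def by blast
      obtain x y where xy: "e = {x, y}" "E x y" using path_edges_walk[OF xs(1) e(1)] by blast
      obtain x' y' where xy': "f = {x', y'}" "E x' y'" using path_edges_walk[OF ys(1) f(1)] by blast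
      have "e \<noteq> f" using e(1) f(1) disj by blast
      then have "z \<in> p ` (e \<inter> f)" using cross[OF xy(2) xy'(2)] e f unfolding xy(1) xy'(1) by blast
      then show ?thesis using path_edges_subset[OF e(1)] path_edges_subset[OF f(1)] by blast
    qed
  qed
qed

lemma walk_in_V: "successively E (x # y # ys) \<Longrightarrow> set (x # y # ys) \<subseteq> V"
proof (induction ys arbitrary: x y)
  case (Cons z zs)
  then show ?case using Cons.IH[of y z] ends[of x y] by simp
qed (use ends sym in auto)

lemma curve_drawn:
  assumes "successively E xs" "set xs \<subseteq> V"
  shows "curve xs \<subseteq> drawn"
proof -
  have "e \<in> {{x, y} |x y. E x y}" if "e \<in> path_edges xs" for e
    using path_edges_walk[OF assms(1) that] by auto
  then have "(\<Union>e\<in>path_edges xs. path_image (c e)) \<subseteq> (\<Union>e\<in>{{x, y} |x y. E x y}. path_image (c e))"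
    by (intro UN_mono) auto
  then show ?thesis using assms(2) unfolding curve_def drawn_def by blast
qed

lemma edge_arc:
  assumes "E x y"
  obtains g where "arc g" "pathstart g = p x" "pathfinish g = p y" "path_image g = curve [x, y]"
proof -
  let ?g = "c {x, y}"
  have g: "arc ?g" "{pathstart ?g, pathfinish ?g} = {p x, p y}" using edge[OF assms] by auto
  then consider "pathstart ?g = p x" "pathfinish ?g = p y" | "pathstart ?g = p y" "pathfinish ?g = p x"
    by (auto simp: doubleton_eq_iff)
  then show ?thesis
  proof cases
    case 1
    then show ?thesis using that[of ?g] g(1) curve_edge[OF assms] by simp
  next
    case 2
    then show ?thesis using that[of "reversepath ?g"] g(1) curve_edge[OF assms]
      by (simp add: arc_reversepath)
  qed
qed

lemma walk_arc:
  assumes "distinct (x # y # ys)" "successively E (x # y # ys)"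
  shows "\<exists>g. arc g \<and> pathstart g = p x \<and> pathfinish g = p (last (y # ys)) \<and>
    path_image g = curve (x # y # ys)"
  using assms
proof (induction ys arbitrary: x y)
  case Nil
  then have "E x y" by simp
  from edge_arc[OF this] show ?case by (metis last.simps)
next
  case (Cons z zs)
  have V: "set (x # y # z # zs) \<subseteq> V" using walk_in_V Cons.prems(2) by blast
  have "E x y" using Cons.prems(2) by simp
  then obtain g where g: "arc g" "pathstart g = p x" "pathfinish g = p y" "path_image g = curve [x, y]"
    by (rule edge_arc)
  have "distinct (y # z # zs)" "successively E (y # z # zs)" using Cons.prems by auto
  from Cons.IH[OF this] obtain h where h: "arc h" "pathstart h = p y"
    "pathfinish h = p (last (z # zs))" "path_image h = curve (y # z # zs)"
    by blast
  have "{x, y} \<notin> path_edges (y # z # zs)"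
    using path_edges_subset[of "{x, y}" "y # z # zs"] Cons.prems(1) by auto
  then have "curve [x, y] \<inter> curve (y # z # zs) = p ` (set [x, y] \<inter> set (y # z # zs))"
    using Cons.prems(2) V by (intro curve_Int) auto
  also have "set [x, y] \<inter> set (y # z # zs) = {y}" using Cons.prems(1) by auto
  finally have "path_image g \<inter> path_image h \<subseteq> {pathstart h}" using g h by simp
  then have "arc (g +++ h)" using g h by (intro arc_join) auto
  moreover have "path_image (g +++ h) = curve (x # y # z # zs)"
  proof -
    have "path_image (g +++ h) = curve [x, y] \<union> curve (y # z # zs)"
      using g h by (simp add: path_image_join)
    then show ?thesis unfolding curve_def by auto
  qed
  ultimately show ?case using g h by (intro exI[of _ "g +++ h"]) simp
qed

definition path_between :: "'a \<Rightarrow> 'a list \<Rightarrow> 'a \<Rightarrow> bool" where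
  "path_between a l b \<longleftrightarrow> distinct (a # l @ [b]) \<and> successively E (a # l @ [b])"

lemma path_between_in_V: "path_between a l b \<Longrightarrow> set (a # l @ [b]) \<subseteq> V"
  using walk_in_V[of a b "[]"] walk_in_V[of a "hd l" "tl l @ [b]"]
  by (cases l) (simp_all add: path_between_def)

lemma path_between_arc:
  assumes "path_between a l b"
  obtains g where "arc g" "pathstart g = p a" "pathfinish g = p b" "path_image g = curve (a # l @ [b])"
proof -
  obtain y ys where y: "l @ [b] = y # ys" by (cases l) auto
  then have "last (y # ys) = b" by (metis last_snoc)
  then show ?thesis using walk_arc[of a y ys] assms that unfolding path_between_def y by metis
qed

lemma closed_curve:
  assumes "path_between a l b"
  shows "closed (curve (a # l @ [b]))"
  using path_between_arc[OF assms] closed_arc_image by metis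

lemma path_between_drawn: "path_between a l b \<Longrightarrow> curve (a # l @ [b]) \<subseteq> drawn"
  using curve_drawn path_between_in_V unfolding path_between_def by blast

text \<open>A common edge would have both ends among the common vertices \<open>a\<close> and
  \<open>b\<close>, so both paths would be this edge; the condition on \<open>l\<close> and
  \<open>m\<close> rules that out.\<close>

lemma paths_theta_arcs:
  assumes l: "path_between a l b" and m: "path_between a m b" and "set l \<inter> set m = {}" "l \<noteq> [] \<or> m \<noteq> []"
    and g: "arc g" "pathstart g = p a" "pathfinish g = p b" "path_image g = curve (a # l @ [b])"
    and h: "arc h" "pathstart h = p a" "pathfinish h = p b" "path_image h = curve (a # m @ [b])"
  shows "theta_arcs (p a) (p b) g h"
proof -
  have dl: "distinct (a # l @ [b])" and wl: "successively E (a # l @ [b])"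
    and dm: "distinct (a # m @ [b])" and wm: "successively E (a # m @ [b])"
    using l m unfolding path_between_def by simp_all
  have int: "set (a # l @ [b]) \<inter> set (a # m @ [b]) = {a, b}" using assms(3) dl dm by auto
  have "path_edges (a # l @ [b]) \<inter> path_edges (a # m @ [b]) = {}"
  proof (rule ccontr)
    assume "\<not> ?thesis"
    then obtain e where e: "e \<in> path_edges (a # l @ [b])" "e \<in> path_edges (a # m @ [b])" by blast
    obtain x y where xy: "e = {x, y}" "E x y"
      using path_edges_walk[OF wl e(1)] by blast
    have "x \<noteq> y" using xy(2) irr by blast
    have "e \<subseteq> {a, b}" unfolding int[symmetric]
      using path_edges_subset[OF e(1)] path_edges_subset[OF e(2)] by (rule Int_greatest)
    then have "e = {a, b}" using xy(1) \<open>x \<noteq> y\<close> by auto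
    then have "l = []" "m = []"
      using e ends_edge_trivial[OF dl] ends_edge_trivial[OF dm] by simp_all
    then show False using assms(4) by simp
  qed
  then have "curve (a # l @ [b]) \<inter> curve (a # m @ [b]) = p ` {a, b}"
    using curve_Int[OF wl path_between_in_V[OF l] wm path_between_in_V[OF m]] unfolding int by blast
  then show ?thesis unfolding theta_arcs_def using g h by simp
qed

text \<open>One of the three arcs runs inside the curve of the other two and, by
  \<open>not_inside\<close>, has no inner vertex; it can only be the third. The conclusion
  \<open>l3 = []\<close> excludes thetas, and the inclusion locates chords of a cycle.\<close>

lemma theta_paths:
  assumes P: "path_between a l1 b" "path_between a l2 b" "path_between a l3 b"
    and disj: "set l1 \<inter> set l2 = {}" "set l1 \<inter> set l3 = {}" "set l2 \<inter> set l3 = {}"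
    and ne: "l1 \<noteq> []" "l2 \<noteq> []"
  shows "curve (a # l3 @ [b]) - {p a, p b} \<subseteq> inside (curve (a # l1 @ [b]) \<union> curve (a # l2 @ [b]))"
    and "l3 = []"
proof -
  obtain g1 where g1: "arc g1" "pathstart g1 = p a" "pathfinish g1 = p b" "path_image g1 = curve (a # l1 @ [b])"
    using path_between_arc[OF P(1)] by blast
  obtain g2 where g2: "arc g2" "pathstart g2 = p a" "pathfinish g2 = p b" "path_image g2 = curve (a # l2 @ [b])"
    using path_between_arc[OF P(2)] by blast
  obtain g3 where g3: "arc g3" "pathstart g3 = p a" "pathfinish g3 = p b" "path_image g3 = curve (a # l3 @ [b])"
    using path_between_arc[OF P(3)] by blast
  have th: "theta_arcs (p a) (p b) g1 g2" "theta_arcs (p a) (p b) g1 g3" "theta_arcs (p a) (p b) g2 g3"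
    using paths_theta_arcs[OF P(1,2) disj(1) _ g1 g2] paths_theta_arcs[OF P(1,3) disj(2) _ g1 g3]
      paths_theta_arcs[OF P(2,3) disj(3) _ g2 g3] ne by blast+
  have no: "l = []" if "path_between a l b" "path_between a m b" "path_between a n b"
    "curve (a # l @ [b]) - {p a, p b} \<subseteq> inside (curve (a # m @ [b]) \<union> curve (a # n @ [b]))" for l m n
  proof (rule ccontr)
    assume "l \<noteq> []"
    then obtain x where x: "x \<in> set l" by (cases l) auto
    have V: "set (a # l @ [b]) \<subseteq> V" by (rule path_between_in_V[OF that(1)])
    have "x \<noteq> a" "x \<noteq> b" using x that(1) by (auto simp: path_between_def)
    then have "p x \<noteq> p a" "p x \<noteq> p b" using inj_onD[OF inj, of x] V x by auto
    moreover have "p x \<in> curve (a # l @ [b])" using x unfolding curve_def by simp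
    ultimately have "p x \<in> inside (curve (a # m @ [b]) \<union> curve (a # n @ [b]))" using that(4) by blast
    moreover have "p x \<notin> inside (curve (a # m @ [b]) \<union> curve (a # n @ [b]))"
      using V x closed_curve path_between_drawn that(2,3) by (intro not_inside) (auto intro: closed_Un)
    ultimately show False by blast
  qed
  from theta_inside[OF th] show in3:
    "curve (a # l3 @ [b]) - {p a, p b} \<subseteq> inside (curve (a # l1 @ [b]) \<union> curve (a # l2 @ [b]))"
    using no[OF P(1,2,3)] no[OF P(2,1,3)] ne unfolding g1(4) g2(4) g3(4) by blast
  show "l3 = []" by (rule no[OF P(3,1,2) in3])
qed

lemma path_through:
  assumes "connected_in E I" "touches E I u" "touches E I v" "u \<notin> I" "v \<notin> I" "u \<noteq> v"
  obtains l where "l \<noteq> []" "set l \<subseteq> I" "path_between u l v"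
proof -
  obtain y z where y: "y \<in> I" "E u y" and z: "z \<in> I" "E v z"
    using assms(2,3) unfolding touches_def by blast
  let ?R = "\<lambda>a b. E a b \<and> a \<in> I \<and> b \<in> I"
  have "?R\<^sup>*\<^sup>* y z" using assms(1) y z unfolding connected_in_def by blast
  then obtain l where l: "l \<noteq> []" "hd l = y" "last l = z" "distinct l" "successively ?R l"
    by (rule rtranclp_distinct_walk)
  have "l = y # tl l" using l(1,2) by (cases l) auto
  have sub: "set l \<subseteq> I"
  proof
    fix x assume "x \<in> set l"
    then have "?R\<^sup>*\<^sup>* y x" using successively_rtranclp[of ?R y "tl l" x] l(5) \<open>l = y # tl l\<close> by metis
    then show "x \<in> I" by (rule rtranclp_mem) (use y in auto)
  qed
  have "successively E l" using l(5) by (rule successively_mono) simp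
  then have "successively E (u # l @ [v])"
    using l y z sym[OF z(2)] by (auto simp: successively_Cons successively_append_iff)
  then have "path_between u l v" using l(4) sub assms(4-6) unfolding path_between_def by auto
  then show ?thesis using that l(1) sub by blast
qed

lemma no_theta:
  assumes uv: "u \<noteq> v" and I: "\<And>I. I \<in> {I1, I2, I3} \<Longrightarrow>
        connected_in E I \<and> u \<notin> I \<and> v \<notin> I \<and> touches E I u \<and> touches E I v"
    and disj: "I1 \<inter> I2 = {}" "I1 \<inter> I3 = {}" "I2 \<inter> I3 = {}"
  shows False
proof -
  have ex: "\<exists>l. l \<noteq> [] \<and> set l \<subseteq> I \<and> path_between u l v" if "I \<in> {I1, I2, I3}" for I
    using I[OF that] path_through[of I u v] uv by metis
  obtain l1 l2 l3 where l: "l1 \<noteq> []" "set l1 \<subseteq> I1" "path_between u l1 v"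
    "l2 \<noteq> []" "set l2 \<subseteq> I2" "path_between u l2 v" "l3 \<noteq> []" "set l3 \<subseteq> I3" "path_between u l3 v"
    using ex[of I1] ex[of I2] ex[of I3] by auto
  have "l3 = []"
    by (rule theta_paths(2)[OF l(3,6,9) _ _ _ l(1,4)]) (use l disj in blast)+
  then show False using l(7) by simp
qed

lemma linking_path:
  assumes "connected_in E K" "A \<subseteq> K" "B \<subseteq> K" "A \<noteq> {}" "B \<noteq> {}" "A \<inter> B = {}"
  obtains x t y where "x \<in> A" "y \<in> B" "path_between x t y" "set t \<subseteq> K - A - B"
proof -
  obtain a b where ab: "a \<in> A" "b \<in> B" using assms by blast
  let ?R = "\<lambda>x y. E x y \<and> x \<in> K \<and> y \<in> K"
  have "?R\<^sup>*\<^sup>* a b" using assms ab unfolding connected_in_def by blast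
  then obtain xs where xs: "xs \<noteq> []" "hd xs = a" "last xs = b" "distinct xs" "successively ?R xs"
    by (rule rtranclp_distinct_walk)
  have "xs = a # tl xs" using xs(1,2) by (cases xs) auto
  have K: "set xs \<subseteq> K"
  proof
    fix x assume "x \<in> set xs"
    then have "?R\<^sup>*\<^sup>* a x" using successively_rtranclp[of ?R a "tl xs" x] xs(5) \<open>xs = a # tl xs\<close> by metis
    then show "x \<in> K" by (rule rtranclp_mem) (use ab assms(2) in auto)
  qed
  have "\<exists>x\<in>set xs. x \<in> A" using xs ab by (metis hd_in_set)
  \<comment> \<open>Taking the last visit to \<open>A\<close> and then the first visit to
    \<open>B\<close> keeps the path in between away from both sets.\<close>
  then obtain ps x qs where x: "xs = ps @ x # qs" "x \<in> A" "\<forall>z\<in>set qs. z \<notin> A"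
    using split_list_last_prop[of xs "\<lambda>x. x \<in> A"] by blast
  have "qs \<noteq> []" using xs(3) x ab(2) assms(6) by auto
  then have "last qs = b" using xs(3) x(1) by simp
  then have "\<exists>y\<in>set qs. y \<in> B" using ab \<open>qs \<noteq> []\<close> last_in_set by metis
  then obtain t y rs where y: "qs = t @ y # rs" "y \<in> B" "\<forall>z\<in>set t. z \<notin> B"
    using split_list_first_prop[of qs "\<lambda>x. x \<in> B"] by blast
  have "successively E xs" using xs(5) by (rule successively_mono) simp
  then have "successively E (ps @ (x # t @ [y]) @ rs)" unfolding x(1) y(1) by simp
  then have "successively E (x # t @ [y])" unfolding successively_append_iff by blast
  then have "path_between x t y" using xs(4) unfolding path_between_def x(1) y(1) by auto
  moreover have "set t \<subseteq> K - A - B" using x(3) y K unfolding x(1) y(1) by auto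
  ultimately show ?thesis using that x(2) y(2) by blast
qed

end

section \<open>Crossing chords of a cycle\<close>

context outerplanar_drawing
begin

lemma curve_append: "curve (xs @ z # ys) = curve (xs @ [z]) \<union> curve (z # ys)"
  unfolding curve_def path_edges_append[of xs z ys] by auto

lemma curve_rev: "curve (rev xs) = curve xs"
  unfolding curve_def path_edges_rev by simp

lemma walk_rev: "successively E xs \<Longrightarrow> successively E (rev xs)"
  unfolding successively_rev by (erule successively_mono) (rule sym)

lemma walk_append: "successively E (xs @ [z]) \<Longrightarrow> successively E (z # ys) \<Longrightarrow> successively E (xs @ z # ys)"
  by (auto simp: successively_append_iff)

lemma vertex_on_curve:
  assumes "path_between a l b" "z \<in> V" "p z \<in> curve (a # l @ [b])"
  shows "z \<in> set (a # l @ [b])"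
proof -
  have V: "set (a # l @ [b]) \<subseteq> V" by (rule path_between_in_V[OF assms(1)])
  have "p z \<in> p ` set (a # l @ [b])"
    using curve_Int_vertices[OF _ V] assms unfolding path_between_def by blast
  then show ?thesis using inj_on_image_mem_iff[OF inj assms(2) V] by simp
qed

text \<open>
  By the theta curves at \<open>u, v\<close> and at \<open>x, y\<close>, both the edge \<open>u v\<close> and the path from \<open>x\<close> to \<open>y\<close> run inside
  the cycle. The edge splits the inside into two parts, and the path, being disjoint from the
  edge, stays in one of them, whose closure misses \<open>x\<close> or \<open>y\<close>.
\<close>

lemma two_chords:
  assumes "E u v" and p1: "path_between u (l1 @ x # m1) v" and p2: "path_between u (l2 @ y # m2) v"
    and disj: "set (l1 @ x # m1) \<inter> set (l2 @ y # m2) = {}"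
    and t: "path_between x t y" "set t \<inter> set (u # v # l1 @ m1 @ l2 @ m2) = {}"
  shows False
proof -
  have uv: "u \<noteq> v" using assms(1) irr by blast
  let ?C1 = "curve (u # (l1 @ x # m1) @ [v])" and ?C2 = "curve (u # (l2 @ y # m2) @ [v])"
    and ?Ce = "curve (u # [] @ [v])" and ?Ct = "curve (x # t @ [y])"
  have pe: "path_between u [] v" using assms(1) uv unfolding path_between_def by simp
  have e: "?Ce - {p u, p v} \<subseteq> inside (?C1 \<union> ?C2)"
    by (rule theta_paths(1)[OF p1 p2 pe disj]) simp_all

  have s1: "successively E ((u # l1 @ [x]) @ (m1 @ [v]))" "successively E ((u # l1) @ (x # m1 @ [v]))"
    and s2: "successively E ((u # l2 @ [y]) @ (m2 @ [v]))" "successively E ((u # l2) @ (y # m2 @ [v]))"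
    using p1 p2 unfolding path_between_def by simp_all
  have w: "successively E (u # l1 @ [x])" "successively E (x # m1 @ [v])"
    "successively E (u # l2 @ [y])" "successively E (y # m2 @ [v])"
    using s1 s2 unfolding successively_append_iff by blast+
  have dist: "distinct (u # (l1 @ x # m1) @ [v])" "distinct (u # (l2 @ y # m2) @ [v])"
    using p1 p2 unfolding path_between_def by blast+
  \<comment> \<open>The same cycle is now read from \<open>x\<close> to \<open>y\<close>, once
    through \<open>u\<close> and once through \<open>v\<close>; these two routes and
    \<open>t\<close> form the second theta.\<close>
  have "successively E (x # (rev l1 @ u # l2) @ [y])"
    using walk_append[of "x # rev l1" u "l2 @ [y]"] walk_rev[OF w(1)] w(3) by simp
  then have P: "path_between x (rev l1 @ u # l2) y"
    using dist disj unfolding path_between_def by auto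
  have "successively E (x # (m1 @ v # rev m2) @ [y])"
    using walk_append[of "x # m1" v "rev m2 @ [y]"] walk_rev[OF w(4)] w(2) by simp
  then have Q: "path_between x (m1 @ v # rev m2) y"
    using dist disj unfolding path_between_def by auto
  have "set (rev l1 @ u # l2) \<inter> set (m1 @ v # rev m2) = {}"
    using dist disj by auto
  moreover have "set (rev l1 @ u # l2) \<inter> set t = {}" "set (m1 @ v # rev m2) \<inter> set t = {}"
    using t(2) by auto
  ultimately have "?Ct - {p x, p y} \<subseteq>
      inside (curve (x # (rev l1 @ u # l2) @ [y]) \<union> curve (x # (m1 @ v # rev m2) @ [y]))"
    by (intro theta_paths(1)[OF P Q t(1)]) simp_all
  moreover have "curve (x # (rev l1 @ u # l2) @ [y]) \<union> curve (x # (m1 @ v # rev m2) @ [y]) = ?C1 \<union> ?C2"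
  proof -
    have "curve (x # (rev l1 @ u # l2) @ [y]) = curve (u # l1 @ [x]) \<union> curve (u # l2 @ [y])"
      using curve_append[of "x # rev l1" u "l2 @ [y]"] curve_rev[of "u # l1 @ [x]"] by simp
    moreover have "curve (x # (m1 @ v # rev m2) @ [y]) = curve (x # m1 @ [v]) \<union> curve (y # m2 @ [v])"
      using curve_append[of "x # m1" v "rev m2 @ [y]"] curve_rev[of "y # m2 @ [v]"] by simp
    moreover have "?C1 = curve (u # l1 @ [x]) \<union> curve (x # m1 @ [v])"
      using curve_append[of "u # l1" x "m1 @ [v]"] by simp
    moreover have "?C2 = curve (u # l2 @ [y]) \<union> curve (y # m2 @ [v])"
      using curve_append[of "u # l2" y "m2 @ [v]"] by simp
    ultimately show ?thesis by blast
  qed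
  ultimately have tin: "?Ct - {p x, p y} \<subseteq> inside (?C1 \<union> ?C2)" by simp

  obtain g1 where g1: "arc g1" "pathstart g1 = p u" "pathfinish g1 = p v" "path_image g1 = ?C1"
    by (rule path_between_arc[OF p1])
  obtain g2 where g2: "arc g2" "pathstart g2 = p u" "pathfinish g2 = p v" "path_image g2 = ?C2"
    by (rule path_between_arc[OF p2])
  obtain g where g: "arc g" "pathstart g = p u" "pathfinish g = p v" "path_image g = ?Ce"
    by (rule path_between_arc[OF pe])
  obtain h where h: "arc h" "pathstart h = p x" "pathfinish h = p y" "path_image h = ?Ct"
    by (rule path_between_arc[OF t(1)])
  have th: "theta_arcs (p u) (p v) g1 g2" "theta_arcs (p u) (p v) g1 g" "theta_arcs (p u) (p v) g2 g"
    using paths_theta_arcs[OF p1 p2 disj _ g1 g2] paths_theta_arcs[OF p1 pe _ _ g1 g]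
      paths_theta_arcs[OF p2 pe _ _ g2 g] by simp_all
  have "p u \<noteq> p v" using arc_distinct_ends[OF g(1)] g by simp
  have "?Ce - {p u, p v} \<noteq> {}"
    using nonempty_simple_path_endless[OF arc_imp_simple_path[OF g(1)]] unfolding g by simp
  then have meet: "path_image g \<inter> inside (path_image g1 \<union> path_image g2) \<noteq> {}"
    using e unfolding g g1 g2 by blast
  have int: "path_image g1 \<inter> path_image g2 = {p u, p v}" "path_image g1 \<inter> path_image g = {p u, p v}"
    "path_image g2 \<inter> path_image g = {p u, p v}"
    using th unfolding theta_arcs_def by blast+
  have split: "inside (?C1 \<union> ?Ce) \<inter> inside (?C2 \<union> ?Ce) = {}"
    "inside (?C1 \<union> ?Ce) \<union> inside (?C2 \<union> ?Ce) \<union> (?Ce - {p u, p v}) = inside (?C1 \<union> ?C2)"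
    using split_inside_simple_closed_curve[OF arc_imp_simple_path[OF g1(1)] g1(2,3)
        arc_imp_simple_path[OF g2(1)] g2(2,3) arc_imp_simple_path[OF g(1)] g(2,3)
        \<open>p u \<noteq> p v\<close> int meet]
    unfolding g g1 g2 by blast+

  have tV: "set (x # t @ [y]) \<subseteq> V" and V1: "set (u # (l1 @ x # m1) @ [v]) \<subseteq> V"
    and V2: "set (u # (l2 @ y # m2) @ [v]) \<subseteq> V" and eV: "set (u # [] @ [v]) \<subseteq> V"
    using path_between_in_V t(1) p1 p2 pe by blast+
  have xy: "x \<notin> {u, v}" "y \<notin> {u, v}" "y \<notin> set (l1 @ x # m1)" "x \<notin> set (l2 @ y # m2)"
    using dist disj by auto
  have "set (x # t @ [y]) \<inter> set (u # [] @ [v]) = {}" using t(2) xy by auto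
  moreover from this have "path_edges (x # t @ [y]) \<inter> path_edges (u # [] @ [v]) = {}"
    using path_edges_subset[of "{u, v}" "x # t @ [y]"] by auto
  ultimately have te: "?Ct \<inter> ?Ce = {}"
    using curve_Int[OF _ tV _ eV] t(1) pe unfolding path_between_def by simp
  let ?S = "?Ct - {p x, p y}"
  have S: "?S \<subseteq> inside (?C1 \<union> ?Ce) \<union> inside (?C2 \<union> ?Ce)" using tin te split(2) by blast
  have cS: "connected ?S" and nS: "p x \<in> closure ?S" "p y \<in> closure ?S"
    using connected_simple_path_endless[OF arc_imp_simple_path[OF h(1)]] arc_endpoints_in_closure[OF h(1)]
    unfolding h by blast+
  have closed: "closed (?C1 \<union> ?Ce)" "closed (?C2 \<union> ?Ce)"
    using closed_curve[OF p1] closed_curve[OF p2] closed_curve[OF pe] by (simp_all add: closed_Un)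
  have drawn: "?C1 \<union> ?Ce \<subseteq> drawn" "?C2 \<union> ?Ce \<subseteq> drawn"
    using path_between_drawn[OF p1] path_between_drawn[OF p2] path_between_drawn[OF pe] by blast+
  have "?S \<subseteq> inside (?C1 \<union> ?Ce) \<or> ?S \<subseteq> inside (?C2 \<union> ?Ce)"
    using connectedD[OF cS open_inside[OF closed(1)] open_inside[OF closed(2)]] S split(1) by blast
  then show False
  proof
    assume "?S \<subseteq> inside (?C1 \<union> ?Ce)"
    then have "p y \<in> ?C1 \<union> ?Ce \<union> inside (?C1 \<union> ?Ce)"
      using closure_mono closure_inside_subset[OF closed(1)] nS(2) by blast
    moreover have "p y \<notin> inside (?C1 \<union> ?Ce)"
      using not_inside[OF _ drawn(1) closed(1)] tV by simp
    moreover have "p y \<notin> ?C1" "p y \<notin> ?Ce"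
      using vertex_on_curve[OF p1, of y] vertex_on_curve[OF pe, of y] tV xy by auto
    ultimately show False by blast
  next
    assume "?S \<subseteq> inside (?C2 \<union> ?Ce)"
    then have "p x \<in> ?C2 \<union> ?Ce \<union> inside (?C2 \<union> ?Ce)"
      using closure_mono closure_inside_subset[OF closed(2)] nS(1) by blast
    moreover have "p x \<notin> inside (?C2 \<union> ?Ce)"
      using not_inside[OF _ drawn(2) closed(2)] tV by simp
    moreover have "p x \<notin> ?C2" "p x \<notin> ?Ce"
      using vertex_on_curve[OF p2, of x] vertex_on_curve[OF pe, of x] tV xy by auto
    ultimately show False by blast
  qed
qed

text \<open>Paths through \<open>I1\<close> and \<open>I2\<close> close up to a cycle through
  \<open>u\<close> and \<open>v\<close>. A link between them inside \<open>K\<close> avoids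
  \<open>u\<close> and \<open>v\<close>, so it is a chord crossing the edge
  \<open>u v\<close>.\<close>

lemma no_K4:
  assumes uv: "E u v" and K: "connected_in E K" "u \<notin> K" "v \<notin> K"
    and I12: "I1 \<subseteq> K" "I2 \<subseteq> K" "I1 \<inter> I2 = {}"
    and I: "\<And>I. I \<in> {I1, I2} \<Longrightarrow> connected_in E I \<and> touches E I u \<and> touches E I v"
  shows False
proof -
  have "u \<noteq> v" using uv irr by blast
  have ex: "\<exists>l. l \<noteq> [] \<and> set l \<subseteq> J \<and> path_between u l v" if "J \<in> {I1, I2}" "J \<subseteq> K" for J
    using I[OF that(1)] path_through[of J u v] that(2) K \<open>u \<noteq> v\<close> by (metis subsetD)
  obtain l1 l2 where l: "l1 \<noteq> []" "set l1 \<subseteq> I1" "path_between u l1 v"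
    "l2 \<noteq> []" "set l2 \<subseteq> I2" "path_between u l2 v"
    using ex[of I1] ex[of I2] I12 by auto
  obtain x t y where xy: "x \<in> set l1" "y \<in> set l2" "path_between x t y" "set t \<subseteq> K - set l1 - set l2"
    by (rule linking_path[OF K(1), of "set l1" "set l2"]) (use l I12 in auto)
  obtain la ma lb mb where split: "l1 = la @ x # ma" "l2 = lb @ y # mb"
    using xy(1,2) by (meson split_list)
  have "set l1 \<inter> set l2 = {}" using l I12 by blast
  moreover have "set t \<inter> set (u # v # la @ ma @ lb @ mb) = {}"
    using xy(4) K(2,3) unfolding split by auto
  ultimately show False
    using two_chords[OF uv, of la x ma lb y mb t] l(3,6) xy(3) unfolding split by blast
qed

lemma outerplanar_relation: "outerplanar_relation E"
proof
  show "E x y \<Longrightarrow> E y x" for x y by (rule sym)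
  show "\<not> E x x" for x by (rule irr)
qed (fact no_theta, fact no_K4)

end

section \<open>Induced subgraphs of maximum degree three\<close>

text \<open>Without parallel arcs, the arcs leaving \<open>v\<close> are determined by their
  heads.\<close>

lemma out_degree_induced:
  assumes "nomulti_digraph G" "v \<in> I"
  shows "out_degree (G \<restriction> I) v = card {y \<in> I. v \<rightarrow>\<^bsub>G\<^esub> y}"
proof -
  interpret nomulti_digraph G by fact
  have inj: "inj_on (head G) (out_arcs (G \<restriction> I) v)"
  proof (rule inj_onI)
    fix e f assume "e \<in> out_arcs (G \<restriction> I) v" "f \<in> out_arcs (G \<restriction> I) v" "head G e = head G f"
    then show "e = f" using no_multi_arcs[of e f] by (simp add: out_arcs_def arc_to_ends_def)
  qed
  have img: "head G ` out_arcs (G \<restriction> I) v = {y \<in> I. v \<rightarrow>\<^bsub>G\<^esub> y}"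
    using assms(2) by (auto simp: out_arcs_def arcs_ends_def arc_to_ends_def image_iff)
  show ?thesis unfolding out_degree_def using card_image[OF inj] img by simp
qed

theorem theorem5:
  fixes G :: "('a, 'b) pre_digraph" and n :: nat
  assumes "n \<ge> 1"
    and "graph G"
    and "card (verts G) = n"
    and "outerplanar G"
  shows "\<exists>I \<subseteq> verts G. max_degree (G \<restriction> I) \<le> 3 \<and> real (card I) \<ge> 2 / 3 * real n"
proof -
  define E where "E x y \<longleftrightarrow> x \<rightarrow>\<^bsub>G\<^esub> y" for x y
  have edges: "edges G = {{x, y} |x y. E x y}" unfolding edges_def E_def ..
  obtain p c where draw: "planar_drawing G p c"
    and outer: "\<forall>v\<in>verts G. p v \<in> frontier (outer_face G p c)"
    using assms(4) unfolding outerplanar_def by blast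
  have sym: "E x y \<Longrightarrow> E y x" and irr: "\<not> E x x" and ends: "E x y \<Longrightarrow> x \<in> verts G" for x y
  proof -
    interpret graph G by fact
    show "E x y \<Longrightarrow> E y x" "\<not> E x x" "E x y \<Longrightarrow> x \<in> verts G"
      unfolding E_def by (erule graph_symmetric, blast dest: adj_not_same, erule adj_in_verts)
  qed
  have "outerplanar_drawing E (verts G) p c"
  proof
    show "E x y \<Longrightarrow> E y x" "\<not> E x x" "E x y \<Longrightarrow> x \<in> verts G" for x y by (fact sym irr ends)+
    show "inj_on p (verts G)" using draw unfolding planar_drawing_def by blast
    show "arc (c {x, y}) \<and> {pathstart (c {x, y}), pathfinish (c {x, y})} = {p x, p y} \<and>
      path_image (c {x, y}) \<inter> p ` verts G = {p x, p y}" if "E x y" for x y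
    proof -
      have "\<forall>e\<in>edges G. arc (c e) \<and> {pathstart (c e), pathfinish (c e)} = p ` e \<and>
          path_image (c e) \<inter> p ` verts G = p ` e"
        using draw unfolding planar_drawing_def by (elim conjE)
      moreover have "{x, y} \<in> edges G" using that unfolding edges by blast
      ultimately have "arc (c {x, y}) \<and> {pathstart (c {x, y}), pathfinish (c {x, y})} = p ` {x, y} \<and>
          path_image (c {x, y}) \<inter> p ` verts G = p ` {x, y}"
        by (rule bspec)
      then show ?thesis unfolding image_insert image_empty .
    qed
    show "path_image (c {x, y}) \<inter> path_image (c {x', y'}) \<subseteq> p ` ({x, y} \<inter> {x', y'})"
      if "E x y" "E x' y'" "{x, y} \<noteq> {x', y'}" for x y x' y'
    proof -
      have xy: "{x, y} \<in> edges G" "{x', y'} \<in> edges G" using that unfolding edges by blast+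
      have "\<forall>e\<in>edges G. \<forall>f\<in>edges G. e \<noteq> f \<longrightarrow>
          path_image (c e) \<inter> path_image (c f) \<subseteq> p ` (e \<inter> f)"
        using draw unfolding planar_drawing_def by (elim conjE)
      from mp[OF bspec[OF bspec[OF this xy(1)] xy(2)] that(3)] show ?thesis .
    qed
    show "p v \<in> frontier (outside (p ` verts G \<union> (\<Union>e\<in>{{x, y} |x y. E x y}. path_image (c e))))"
      if "v \<in> verts G" for v
      using bspec[OF outer that] unfolding outer_face_def drawing_points_def edges .
  qed
  then interpret R: outerplanar_relation E by (rule outerplanar_drawing.outerplanar_relation)
  interpret graph G by fact
  obtain xs where xs: "noncrossing E xs" "set xs = verts G"
    using R.ex_noncrossing_order[OF finite_verts] by blast
  have "length xs = n"
    using distinct_card[OF noncrossing_distinct[OF xs(1)]] xs(2) assms(3) by simp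
  have "\<exists>I\<subseteq>set xs. (\<forall>x\<in>I. card {y \<in> I. E x y} \<le> 3) \<and> 2 * length xs \<le> 3 * card I"
    by (rule noncrossing_large_subset[OF _ _ xs(1)], erule sym, rule irr)
  then obtain I where I: "I \<subseteq> verts G" "\<forall>x\<in>I. card {y \<in> I. E x y} \<le> 3" "2 * length xs \<le> 3 * card I"
    unfolding xs(2) by blast
  have "out_degree (G \<restriction> I) v \<le> 3" if "v \<in> I" for v
    using out_degree_induced[OF nomulti_digraph that] I(2) that unfolding E_def by simp
  moreover have "finite I" using I(1) finite_verts by (rule finite_subset)
  ultimately have "max_degree (G \<restriction> I) \<le> 3" unfolding max_degree_def by simp
  moreover have "real (card I) \<ge> 2 / 3 * real n" using I(3) \<open>length xs = n\<close> by linarith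
  ultimately show ?thesis using I(1) by blast
qed

end
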